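(* Let $\Bbbk$ be a field, let $G=(V,E)$ be a nonempty finite simple graph, and set $$A_G=\Bbbk[x_v:v\in V]/\bigl(x_v^2\ (v\in V),\ x_ux_v\ (u\ne v,\ \{u,v\}\notin E),\ x_ux_vx_w\ (u,v,w\in V\text{ distinct})\bigr),$$ with graded maximal ideal $\mathfrak m=(x_v:v\in V)A_G$. If $G=K_1$ or $G=K_2$, then $A_G$ is Gorenstein and $\operatorname{tr}(\omega_{A_G})=A_G$. In every other case, $$\operatorname{tr}(\omega_{A_G})=\mathfrak m^2+\bigl(x_v:\deg_G(v)\le1\text{ or the connected component of }v\text{ in }G\text{ is isomorphic to }C_3\bigr).$$
   Context: $\deg_G(v)$ is the number of neighbors of $v$ in $G$; $K_1,K_2$ are the complete graphs on one and two vertices, and $C_3$ is the triangle graph (complete graph on three vertices). For an Artinian positively graded $\Bbbk$-algebra $A$ (with $A_0=\Bbbk$), the canonical module is $\omega_A=\operatorname{Hom}_{\Bbbk}(A,\Bbbk)$ with $(a\lambda)(b)=\lambda(ab)$, and the canonical trace is the ideal $\operatorname{tr}(\omega_A)=\operatorname{tr}_A(\omega_A)=\sum_{\varphi\in\operatorname{Hom}_A(\omega_A,A)}\varphi(\omega_A)$. $A$ is Gorenstein if and only if its socle is one-dimensional over $\Bbbk$. *)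

theory Defs
  imports
    "HOL-Library.Poly_Mapping"
    "HOL-Algebra.Algebra"
    "HOL-Algebra.Algebraic_Closure_Type"
    "Graph_Theory.Graph_Theory"
begin

section \<open>Canonical module and canonical trace\<close>

definition regular_module :: "('a, 'm) ring_scheme \<Rightarrow> ('a, 'a) module" where
  "regular_module R = \<lparr> carrier = carrier R, monoid.mult = monoid.mult R, one = one R,
     ring.zero = ring.zero R, add = add R, module.smult = monoid.mult R \<rparr>"

text \<open>Homomorphisms are extensional functions, so that equality of homomorphisms is equality
  on the carrier.\<close>

definition mod_hom ::
  "('r, 'm) ring_scheme \<Rightarrow> ('r, 'a, 'p) module_scheme \<Rightarrow> ('r, 'b, 'q) module_scheme \<Rightarrow> ('a \<Rightarrow> 'b) set"
where
  "mod_hom R M N = {f \<in> carrier M \<rightarrow>\<^sub>E carrier N.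
     (\<forall>x\<in>carrier M. \<forall>y\<in>carrier M. f (x \<oplus>\<^bsub>M\<^esub> y) = f x \<oplus>\<^bsub>N\<^esub> f y) \<and>
     (\<forall>r\<in>carrier R. \<forall>x\<in>carrier M. f (r \<odot>\<^bsub>M\<^esub> x) = r \<odot>\<^bsub>N\<^esub> f x)}"

text \<open>A \<open>K\<close>-algebra is a record \<open>A\<close> with \<open>algebra K A\<close>: \<open>smult\<close> is the action of \<open>K\<close>.
  The canonical module is \<open>Hom\<^sub>K(A, K)\<close> with \<open>(a\<lambda>)(b) = \<lambda>(ab)\<close>.  The record type of modules
  extends that of rings; the fields \<open>mult\<close> and \<open>one\<close> play no role in a module.\<close>

definition canonical_module ::
  "('k, 'm) ring_scheme \<Rightarrow> ('k, 'a, 'p) module_scheme \<Rightarrow> ('a, 'a \<Rightarrow> 'k) module"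
where
  "canonical_module K A = \<lparr> carrier = mod_hom K A (regular_module K),
     monoid.mult = undefined, one = undefined,
     ring.zero = (\<lambda>x\<in>carrier A. \<zero>\<^bsub>K\<^esub>),
     add = (\<lambda>f g. \<lambda>x\<in>carrier A. f x \<oplus>\<^bsub>K\<^esub> g x),
     module.smult = (\<lambda>a f. \<lambda>b\<in>carrier A. f (a \<otimes>\<^bsub>A\<^esub> b)) \<rparr>"

text \<open>The sum of the images of all \<open>A\<close>-linear maps \<open>\<omega>\<^sub>A \<rightarrow> A\<close>; a sum of a family of
  additive subgroups is the additive subgroup generated by their union.\<close>

definition canonical_trace :: "('k, 'm) ring_scheme \<Rightarrow> ('k, 'a, 'p) module_scheme \<Rightarrow> 'a set" where
  "canonical_trace K A = generate (add_monoid A)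
     (\<Union>\<phi>\<in>mod_hom A (canonical_module K A) (regular_module A). \<phi> ` carrier (canonical_module K A))"

text \<open>The socle of a local (or positively graded) algebra with maximal ideal \<open>M\<close> is the
  annihilator of \<open>M\<close>.  An Artinian positively graded \<open>K\<close>-algebra with degree-zero part \<open>K\<close>
  is Gorenstein iff its socle is one-dimensional, and this is what is taken as definition;
  the dimension is over the copy \<open>{c \<cdot> 1 | c \<in> K}\<close> of \<open>K\<close> inside \<open>A\<close>.\<close>

definition socle :: "('a, 'm) ring_scheme \<Rightarrow> 'a set \<Rightarrow> 'a set" where
  "socle A M = {a \<in> carrier A. \<forall>x\<in>M. x \<otimes>\<^bsub>A\<^esub> a = \<zero>\<^bsub>A\<^esub>}"

definition artinian_gorenstein ::
  "('k, 'm) ring_scheme \<Rightarrow> ('k, 'a, 'p) module_scheme \<Rightarrow> 'a set \<Rightarrow> bool" where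
  "artinian_gorenstein K A M \<longleftrightarrow>
     ring.dimension A 1 ((\<lambda>c. c \<odot>\<^bsub>A\<^esub> \<one>\<^bsub>A\<^esub>) ` carrier K) (socle A M)"

section \<open>The algebra of a graph\<close>

text \<open>A monomial is encoded as its finitely supported exponent vector \<open>'v \<Rightarrow>\<^sub>0 nat\<close>.\<close>

type_synonym ('v, 'k) mpoly = "('v \<Rightarrow>\<^sub>0 nat) \<Rightarrow>\<^sub>0 'k"

definition mpoly_ring :: "'v set \<Rightarrow> ('v, 'k::field) mpoly ring" where
  "mpoly_ring V = \<lparr> carrier = {p. \<forall>m\<in>Poly_Mapping.keys p. Poly_Mapping.keys m \<subseteq> V},
     monoid.mult = (*), one = 1, ring.zero = 0, add = (+) \<rparr>"

definition mpoly_const :: "'k \<Rightarrow> ('v, 'k::field) mpoly" where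
  "mpoly_const c = Poly_Mapping.single 0 c"

definition mpoly_var :: "'v \<Rightarrow> ('v, 'k::field) mpoly" where
  "mpoly_var v = Poly_Mapping.single (Poly_Mapping.single v 1) 1"

text \<open>Simple graphs are the symmetric loop-free digraphs without parallel arcs, as in the
  locale \<open>graph\<close>; \<open>dominates G u v\<close> says that \<open>{u, v}\<close> is an edge.\<close>

definition graph_relations :: "('v, 'e) pre_digraph \<Rightarrow> ('v, 'k::field) mpoly set" where
  "graph_relations G =
     {mpoly_var v ^ 2 | v. v \<in> verts G} \<union>
     {mpoly_var u * mpoly_var v | u v.
        u \<in> verts G \<and> v \<in> verts G \<and> u \<noteq> v \<and> \<not> dominates G u v} \<union>
     {mpoly_var u * mpoly_var v * mpoly_var w | u v w.
        u \<in> verts G \<and> v \<in> verts G \<and> w \<in> verts G \<and> u \<noteq> v \<and> u \<noteq> w \<and> v \<noteq> w}"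

definition graph_ideal :: "('v, 'e) pre_digraph \<Rightarrow> ('v, 'k::field) mpoly set" where
  "graph_ideal G = genideal (mpoly_ring (verts G)) (graph_relations G)"

definition residue_class :: "('v, 'e) pre_digraph \<Rightarrow> ('v, 'k::field) mpoly \<Rightarrow> ('v, 'k) mpoly set" where
  "residue_class G p = graph_ideal G +>\<^bsub>mpoly_ring (verts G)\<^esub> p"

definition graph_algebra :: "('v, 'e) pre_digraph \<Rightarrow> ('k::field, ('v, 'k) mpoly set) module" where
  "graph_algebra G = (let Q = mpoly_ring (verts G) Quot graph_ideal G in
     \<lparr> carrier = carrier Q, monoid.mult = monoid.mult Q, one = one Q,
       ring.zero = ring.zero Q, add = add Q,
       module.smult = (\<lambda>c a. residue_class G (mpoly_const c) \<otimes>\<^bsub>Q\<^esub> a) \<rparr>)"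

definition graph_max_ideal :: "('v, 'e) pre_digraph \<Rightarrow> ('v, 'k::field) mpoly set set" where
  "graph_max_ideal G =
     genideal (graph_algebra G) {residue_class G (mpoly_var v) | v. v \<in> verts G}"

definition degree_of :: "('v, 'e) pre_digraph \<Rightarrow> 'v \<Rightarrow> nat" where
  "degree_of G v = card {u. dominates G v u}"

text \<open>In a symmetric digraph the strongly connected components are the connected components.\<close>

definition component :: "('v, 'e) pre_digraph \<Rightarrow> 'v \<Rightarrow> ('v, 'e) pre_digraph" where
  "component G v = G \<restriction> pre_digraph.scc_of G v"

end

theory Submission
  imports Defs
begin

text \<open>
  A monomial is called standard if it does not lie in the ideal of relations; the standard monomials are
  \<open>1\<close>, the variables and the products over edges, and they form a basis of \<open>A\<^sub>G\<close>.  With respect to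
  this basis and its dual, a homomorphism from \<open>\<omega>\<close> to \<open>A\<^sub>G\<close> is a matrix \<open>c(s, t)\<close> indexed by pairs of
  standard monomials, subject to \<open>c(s, mt) = c(ms, t)\<close>, where \<open>c(s, t')\<close> and \<open>c(s', t)\<close> vanish
  if \<open>ms\<close>, respectively \<open>mt\<close>, is standard and \<open>m\<close> does not divide \<open>t'\<close>, respectively \<open>s'\<close>.
  Playing these relations against each other forces \<open>c(s, t) = 0\<close> for \<open>t = 1\<close>, if \<open>G\<close> is neither
  \<open>K\<^sub>1\<close> nor \<open>K\<^sub>2\<close>, and for \<open>t = x\<^sub>v\<close>, unless \<open>v\<close> is of the kind named in the theorem.

  Conversely, for suitable monomials \<open>N\<close> the matrix with \<open>c(s, t) = 1\<close> if \<open>st = N\<close> and \<open>0\<close> otherwise is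
  a homomorphism, and its image contains every standard \<open>t\<close> that occurs in such a factorization.
  The choices are \<open>(x\<^sub>ux\<^sub>v)\<^sup>2\<close> for an edge, \<open>x\<^sub>v\<^sup>2\<close> for an isolated
  vertex, \<open>x\<^sub>v\<^sup>2x\<^sub>w\<close> for a leaf \<open>v\<close> with neighbour \<open>w\<close>, \<open>x\<^sub>ux\<^sub>vx\<^sub>w\<close> for a triangle
  component, and the product of all variables for \<open>K\<^sub>1\<close> and \<open>K\<^sub>2\<close>.
\<close>

section \<open>Coefficients of monomial multiples\<close>

abbreviation lookup where "lookup \<equiv> Poly_Mapping.lookup"

text \<open>By cancellation \<open>t\<close> is the only exponent that completes \<open>s\<close> to
  \<open>s + t\<close>, so a single product of coefficients contributes.\<close>

lemma lookup_single_mult: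
  fixes p :: "'a::cancel_comm_monoid_add \<Rightarrow>\<^sub>0 'b::semiring_0"
  shows "lookup (Poly_Mapping.single s c * p) (s + t) = c * lookup p t"
  by (simp add: lookup_mult lookup_single when_mult)

lemma lookup_mult_nonzeroE:
  fixes p q :: "'a::monoid_add \<Rightarrow>\<^sub>0 'b::semiring_0"
  assumes "lookup (p * q) t \<noteq> 0"
  obtains a b where "t = a + b" "lookup p a \<noteq> 0" "lookup q b \<noteq> 0"
  using assms keys_mult[of p q] by (fastforce simp: in_keys_iff)

lemma poly_mapping_sum_single:
  fixes p :: "'a \<Rightarrow>\<^sub>0 'b::comm_monoid_add"
  assumes "finite S" "Poly_Mapping.keys p \<subseteq> S"
  shows "p = (\<Sum>m\<in>S. Poly_Mapping.single m (lookup p m))"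
proof (rule poly_mapping_eqI)
  fix k
  have "lookup (\<Sum>m\<in>S. Poly_Mapping.single m (lookup p m)) k = (\<Sum>m\<in>S. if k = m then lookup p m else 0)"
    by (auto simp: lookup_sum lookup_single when_def intro!: sum.cong)
  also have "\<dots> = lookup p k"
    using assms by (auto simp: sum.delta in_keys_iff)
  finally show "lookup p k = lookup (\<Sum>m\<in>S. Poly_Mapping.single m (lookup p m)) k" by simp
qed

lemma keys_add_nat: "Poly_Mapping.keys (s + t :: 'v \<Rightarrow>\<^sub>0 nat) = Poly_Mapping.keys s \<union> Poly_Mapping.keys t"
  by (auto simp: in_keys_iff lookup_add)

lemma monomial_dvdE:
  fixes s m :: "'v \<Rightarrow>\<^sub>0 nat"
  assumes "\<And>v. lookup s v \<le> lookup m v"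
  obtains u where "m = s + u"
proof
  show "m = s + (m - s)"
    using assms by (intro poly_mapping_eqI) (simp add: lookup_add lookup_minus)
qed

abbreviation var_exp :: "'v \<Rightarrow> ('v \<Rightarrow>\<^sub>0 nat)"
  where "var_exp v \<equiv> Poly_Mapping.single v (Suc 0)"

lemma var_exp_nonzero: "var_exp v \<noteq> 0"
  by (metis lookup_single_eq lookup_zero nat.distinct(2))

lemma var_exp_dvdE:
  assumes "lookup (m :: 'v \<Rightarrow>\<^sub>0 nat) v \<noteq> 0"
  obtains u where "m = var_exp v + u"
proof -
  have "lookup (var_exp v) u \<le> lookup m u" for u
    using assms by (auto simp: lookup_single when_def)
  then show ?thesis using that by (rule monomial_dvdE)
qed

section \<open>The polynomial ring and its monomial ideals\<close>

lemma carrier_mpoly_ring: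
  "p \<in> carrier (mpoly_ring V) \<longleftrightarrow> (\<forall>m. lookup p m \<noteq> 0 \<longrightarrow> Poly_Mapping.keys m \<subseteq> V)"
  by (auto simp: mpoly_ring_def in_keys_iff)

lemma mpoly_ring_simps:
  "x \<otimes>\<^bsub>mpoly_ring V\<^esub> y = x * y" "x \<oplus>\<^bsub>mpoly_ring V\<^esub> y = x + y"
  "\<zero>\<^bsub>mpoly_ring V\<^esub> = 0" "\<one>\<^bsub>mpoly_ring V\<^esub> = 1"
  by (simp_all add: mpoly_ring_def)

lemma mpoly_carrier_closed:
  "0 \<in> carrier (mpoly_ring V)" "1 \<in> carrier (mpoly_ring V)"
  "p \<in> carrier (mpoly_ring V) \<Longrightarrow> q \<in> carrier (mpoly_ring V) \<Longrightarrow> p + q \<in> carrier (mpoly_ring V)"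
  "p \<in> carrier (mpoly_ring V) \<Longrightarrow> q \<in> carrier (mpoly_ring V) \<Longrightarrow> p - q \<in> carrier (mpoly_ring V)"
  "p \<in> carrier (mpoly_ring V) \<Longrightarrow> - p \<in> carrier (mpoly_ring V)"
  "p \<in> carrier (mpoly_ring V) \<Longrightarrow> q \<in> carrier (mpoly_ring V) \<Longrightarrow> p * q \<in> carrier (mpoly_ring V)"
  "Poly_Mapping.keys m \<subseteq> V \<Longrightarrow> Poly_Mapping.single m c \<in> carrier (mpoly_ring V)"
proof -
  show "p * q \<in> carrier (mpoly_ring V)"
    if "p \<in> carrier (mpoly_ring V)" "q \<in> carrier (mpoly_ring V)"
    using that unfolding carrier_mpoly_ring
    by (metis (no_types, lifting) Un_least keys_add_nat lookup_mult_nonzeroE)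
  show "p - q \<in> carrier (mpoly_ring V)"
    if "p \<in> carrier (mpoly_ring V)" "q \<in> carrier (mpoly_ring V)"
    using that unfolding carrier_mpoly_ring lookup_minus by (metis diff_0_right)
  show "p + q \<in> carrier (mpoly_ring V)"
    if "p \<in> carrier (mpoly_ring V)" "q \<in> carrier (mpoly_ring V)"
    using that unfolding carrier_mpoly_ring lookup_add by (metis add_0)
qed (auto simp: carrier_mpoly_ring lookup_one lookup_single when_def)

lemma cring_mpoly_ring: "cring (mpoly_ring V)"
proof (rule cringI)
  show "abelian_group (mpoly_ring V)"
  proof (rule abelian_groupI)
    fix x assume "x \<in> carrier (mpoly_ring V)"
    then show "\<exists>y\<in>carrier (mpoly_ring V). y \<oplus>\<^bsub>mpoly_ring V\<^esub> x = \<zero>\<^bsub>mpoly_ring V\<^esub>"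
      by (intro bexI[of _ "- x"]) (auto simp: mpoly_ring_simps mpoly_carrier_closed)
  qed (auto simp: mpoly_ring_simps mpoly_carrier_closed algebra_simps)
  show "comm_monoid (mpoly_ring V)"
    by (rule comm_monoidI) (auto simp: mpoly_ring_simps mpoly_carrier_closed algebra_simps)
qed (auto simp: mpoly_ring_simps algebra_simps)

text \<open>For \<open>S\<close> closed under divisors this is the monomial ideal spanned by the
  monomials over \<open>V\<close> outside \<open>S\<close>. Membership is thus a condition on single
  coefficients.\<close>

definition coeff_ideal :: "'v set \<Rightarrow> ('v \<Rightarrow>\<^sub>0 nat) set \<Rightarrow> ('v, 'k::field) mpoly set" where
  "coeff_ideal V S = {p \<in> carrier (mpoly_ring V). \<forall>t\<in>S. lookup p t = 0}"

text \<open>A term of \<open>p * q\<close> in \<open>S\<close> would have a divisor among the terms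
  of \<open>p\<close>. Closure under divisors puts that divisor into \<open>S\<close>, where
  \<open>p\<close> has no terms.\<close>

lemma ideal_coeff_ideal:
  fixes V :: "'v set"
  assumes "\<And>s t. s + t \<in> S \<Longrightarrow> s \<in> S"
  shows "ideal (coeff_ideal V S :: ('v, 'k::field) mpoly set) (mpoly_ring V)"
proof -
  interpret cring "mpoly_ring V :: ('v, 'k) mpoly ring" by (rule cring_mpoly_ring)
  have mult: "p * q \<in> coeff_ideal V S"
    if "p \<in> coeff_ideal V S" "q \<in> carrier (mpoly_ring V)" for p q :: "('v, 'k) mpoly"
    using that assms unfolding coeff_ideal_def
    by (auto simp: mpoly_carrier_closed) (metis lookup_mult_nonzeroE)
  have minus: "\<ominus>\<^bsub>mpoly_ring V\<^esub> p = - p" if "p \<in> carrier (mpoly_ring V)" for p :: "('v, 'k) mpoly"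
    by (rule minus_equality) (use that in \<open>auto simp: mpoly_ring_simps mpoly_carrier_closed\<close>)
  show ?thesis
  proof (rule idealI)
    show "subgroup (coeff_ideal V S :: ('v, 'k) mpoly set) (add_monoid (mpoly_ring V))"
      by (rule add.subgroupI)
        (auto simp: coeff_ideal_def mpoly_ring_simps mpoly_carrier_closed lookup_add minus
          intro!: exI[of _ 0])
  qed (use mult in \<open>auto simp: mpoly_ring_simps ring_axioms mult.commute\<close>)
qed

section \<open>Standard monomials\<close>

text \<open>Besides confining the support to the graph, each clause excludes one family of
  relations: squares, products of three variables, and non-edges. All clauses pass to
  divisors.\<close>

definition standard_monomials :: "('v, 'e) pre_digraph \<Rightarrow> ('v \<Rightarrow>\<^sub>0 nat) set" where
  "standard_monomials G = {m. Poly_Mapping.keys m \<subseteq> verts G \<and> (\<forall>v. lookup m v \<le> 1) \<and>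
     card (Poly_Mapping.keys m) \<le> 2 \<and>
     (\<forall>u\<in>Poly_Mapping.keys m. \<forall>v\<in>Poly_Mapping.keys m. u \<noteq> v \<longrightarrow> dominates G u v)}"

lemma standard_monomials_divisor:
  assumes "s + t \<in> standard_monomials G"
  shows "s \<in> standard_monomials G"
proof -
  have "card (Poly_Mapping.keys s) \<le> card (Poly_Mapping.keys (s + t))"
    by (rule card_mono) (auto simp: keys_add_nat)
  moreover have "lookup s v \<le> lookup (s + t) v" for v
    by (simp add: lookup_add)
  ultimately show ?thesis
    using assms unfolding standard_monomials_def
    by (fastforce simp: keys_add_nat intro: order_trans)
qed

lemma standard_monomials_divisor':
  assumes "s + t \<in> standard_monomials G"
  shows "t \<in> standard_monomials G"
  using standard_monomials_divisor[of t s G] assms by (simp add: add.commute)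

context graph
begin

lemma edge_in_verts: "u \<rightarrow> v \<Longrightarrow> u \<in> verts G" "u \<rightarrow> v \<Longrightarrow> v \<in> verts G"
  by (auto simp: adj_in_verts)

lemma edge_sym: "u \<rightarrow> v \<Longrightarrow> v \<rightarrow> u"
  using sym_arcs by (auto simp: symmetric_def sym_def)

lemma edge_neq: "u \<rightarrow> v \<Longrightarrow> u \<noteq> v"
  using adj_not_same by blast

lemma standard_monomials_eq:
  "standard_monomials G = {0} \<union> {var_exp v |v. v \<in> verts G} \<union> {var_exp u + var_exp v |u v. u \<rightarrow> v}"
proof (intro subset_antisym subsetI)
  fix m assume m: "m \<in> standard_monomials G"
  have eq: "m = (\<Sum>v\<in>Poly_Mapping.keys m. var_exp v)"
  proof -
    have "lookup m v = 1" if "v \<in> Poly_Mapping.keys m" for v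
      using m that by (auto simp: standard_monomials_def in_keys_iff intro!: antisym)
    then show ?thesis
      by (subst poly_mapping_sum_single[of "Poly_Mapping.keys m" m]) (auto intro!: sum.cong)
  qed
  have "card (Poly_Mapping.keys m) \<le> 2" using m by (simp add: standard_monomials_def)
  then consider "card (Poly_Mapping.keys m) = 0" | "card (Poly_Mapping.keys m) = 1" | "card (Poly_Mapping.keys m) = 2"
    by linarith
  then show "m \<in> {0} \<union> {var_exp v |v. v \<in> verts G} \<union> {var_exp u + var_exp v |u v. u \<rightarrow> v}"
  proof cases
    case 1 then show ?thesis using eq by simp
  next
    case 2
    then obtain v where v: "Poly_Mapping.keys m = {v}" by (auto simp: card_1_singleton_iff)
    then have "v \<in> verts G" "m = var_exp v" using m eq by (auto simp: standard_monomials_def)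
    then show ?thesis by blast
  next
    case 3
    then obtain u v where uv: "Poly_Mapping.keys m = {u, v}" "u \<noteq> v" by (auto simp: card_2_iff)
    then have "u \<rightarrow> v" "m = var_exp u + var_exp v" using m eq by (auto simp: standard_monomials_def)
    then show ?thesis by blast
  qed
next
  fix m assume "m \<in> {0} \<union> {var_exp v |v. v \<in> verts G} \<union> {var_exp u + var_exp v |u v. u \<rightarrow> v}"
  then show "m \<in> standard_monomials G"
    by (auto simp: standard_monomials_def keys_add_nat edge_in_verts edge_sym lookup_add lookup_single
        when_def card_insert_if dest: edge_neq)
qed

lemma zero_standard: "0 \<in> standard_monomials G"
  by (simp add: standard_monomials_eq)

lemma var_standard: "var_exp v \<in> standard_monomials G \<longleftrightarrow> v \<in> verts G"
  by (auto simp: standard_monomials_def lookup_single when_def)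

lemma edge_standard:
  "var_exp u + var_exp v \<in> standard_monomials G \<longleftrightarrow> u \<rightarrow> v" (is "?l = ?r")
proof
  assume l: ?l
  then have "lookup (var_exp u + var_exp v) u \<le> 1" by (simp add: standard_monomials_def)
  then have "u \<noteq> v" by (auto simp: lookup_add lookup_single)
  then show ?r using l by (auto simp: standard_monomials_def keys_add_nat)
qed (auto simp: standard_monomials_eq)

lemma finite_standard_monomials: "finite (standard_monomials G)"
proof -
  have "standard_monomials G \<subseteq> {0} \<union> var_exp ` verts G \<union> (\<lambda>(u, v). var_exp u + var_exp v) ` arcs_ends G"
    unfolding standard_monomials_eq by force
  then show ?thesis
    by (rule finite_subset) (auto simp: arcs_ends_def)
qed

lemma mpoly_var_square: "mpoly_var v ^ 2 = Poly_Mapping.single (var_exp v + var_exp v) 1"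
  by (simp add: power2_eq_square mpoly_var_def mult_single)

lemma graph_relations_subset:
  "graph_relations G \<subseteq> coeff_ideal (verts G) (standard_monomials G)"
proof -
  have "Poly_Mapping.single m 1 \<in> coeff_ideal (verts G) (standard_monomials G)"
    if "Poly_Mapping.keys m \<subseteq> verts G" "m \<notin> standard_monomials G" for m
    using that by (auto simp: coeff_ideal_def mpoly_carrier_closed lookup_single when_def)
  note * = this
  have "var_exp v + var_exp v \<notin> standard_monomials G" for v
    using edge_standard edge_neq by blast
  moreover have "var_exp u + var_exp v + var_exp w \<notin> standard_monomials G"
    if "u \<noteq> v" "u \<noteq> w" "v \<noteq> w" for u v w
    using that by (auto simp: standard_monomials_def keys_add_nat card_insert_if)
  ultimately show ?thesis
    unfolding graph_relations_def mpoly_var_square unfolding mpoly_var_def mult_single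
    by (auto simp: keys_add_nat edge_standard intro!: *)
qed

text \<open>The generators are nonstandard monomials, and standardness passes to divisors, which
  gives one inclusion. Conversely, every nonstandard monomial over the vertices is a multiple of a
  generator.\<close>

lemma graph_ideal_eq: "(graph_ideal G :: ('a, 'k::field) mpoly set) = coeff_ideal (verts G) (standard_monomials G)"
proof (rule subset_antisym)
  interpret cring "mpoly_ring (verts G) :: ('a, 'k) mpoly ring" by (rule cring_mpoly_ring)
  show "(graph_ideal G :: ('a, 'k) mpoly set) \<subseteq> coeff_ideal (verts G) (standard_monomials G)"
    unfolding graph_ideal_def
    by (intro genideal_minimal ideal_coeff_ideal graph_relations_subset) (rule standard_monomials_divisor)
  have rel: "(graph_relations G :: ('a, 'k) mpoly set) \<subseteq> carrier (mpoly_ring (verts G))"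
    using graph_relations_subset by (auto simp: coeff_ideal_def)
  interpret I: ideal "graph_ideal G :: ('a, 'k) mpoly set" "mpoly_ring (verts G)"
    unfolding graph_ideal_def by (rule genideal_ideal[OF rel])
  have mult: "Poly_Mapping.single m c \<in> graph_ideal G"
    if rel_s: "Poly_Mapping.single s (1::'k) \<in> graph_relations G" and m: "Poly_Mapping.keys m \<subseteq> verts G"
      and le: "\<And>v. lookup s v \<le> lookup m v" for s m and c :: 'k
  proof -
    obtain u where u: "m = s + u" using le by (rule monomial_dvdE)
    have "Poly_Mapping.single s (1::'k) \<in> graph_ideal G"
      using genideal_self[OF rel] rel_s unfolding graph_ideal_def by blast
    then have "Poly_Mapping.single u c \<otimes>\<^bsub>mpoly_ring (verts G)\<^esub> Poly_Mapping.single s 1 \<in> graph_ideal G"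
      using m by (intro I.I_l_closed) (auto simp: u keys_add_nat mpoly_carrier_closed)
    then show ?thesis by (simp add: u mpoly_ring_simps mult_single add.commute)
  qed
  have nonstd: "Poly_Mapping.single m c \<in> graph_ideal G"
    if m: "Poly_Mapping.keys m \<subseteq> verts G" "m \<notin> standard_monomials G" for m and c :: 'k
  proof -
    \<comment> \<open>The violated clause of standardness names the relation that divides
      \<open>m\<close>: a square, a non-edge or a product of three variables.\<close>
    consider v where "lookup m v > 1"
      | u v where "u \<in> Poly_Mapping.keys m" "v \<in> Poly_Mapping.keys m" "u \<noteq> v" "\<not> u \<rightarrow> v"
      | "card (Poly_Mapping.keys m) \<ge> 3"
      using m unfolding standard_monomials_def mem_Collect_eq
      by (metis Suc_leI eval_nat_numeral(3) not_le)
    then show ?thesis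
    proof cases
      case 1
      then have "v \<in> verts G" using m by (force simp: in_keys_iff)
      then have "Poly_Mapping.single (var_exp v + var_exp v) (1::'k) \<in> graph_relations G"
        unfolding graph_relations_def mpoly_var_square[symmetric] by blast
      then show ?thesis using 1 m(1)
        by (intro mult[of "var_exp v + var_exp v"]) (auto simp: lookup_add lookup_single when_def)
    next
      case 2
      then have "u \<in> verts G" "v \<in> verts G" using m(1) by auto
      with 2 have "mpoly_var u * mpoly_var v \<in> (graph_relations G :: ('a, 'k) mpoly set)"
        unfolding graph_relations_def by blast
      then have "Poly_Mapping.single (var_exp u + var_exp v) (1::'k) \<in> graph_relations G"
        by (simp add: mpoly_var_def mult_single)
      then show ?thesis using m(1) 2
        by (intro mult[of "var_exp u + var_exp v"])
          (auto simp: lookup_add lookup_single when_def in_keys_iff)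
    next
      case 3
      then obtain T where T: "T \<subseteq> Poly_Mapping.keys m" "card T = 3"
        by (meson obtain_subset_with_card_n)
      then obtain u v w where uvw: "T = {u, v, w}" "u \<noteq> v" "u \<noteq> w" "v \<noteq> w"
        by (auto simp: card_3_iff)
      with T m(1) have k: "u \<in> Poly_Mapping.keys m" "v \<in> Poly_Mapping.keys m" "w \<in> Poly_Mapping.keys m"
        "u \<in> verts G" "v \<in> verts G" "w \<in> verts G" by auto
      have "mpoly_var u * mpoly_var v * mpoly_var w \<in> (graph_relations G :: ('a, 'k) mpoly set)"
        using uvw k unfolding graph_relations_def by blast
      then have "Poly_Mapping.single (var_exp u + var_exp v + var_exp w) (1::'k) \<in> graph_relations G"
        by (simp add: mpoly_var_def mult_single)
      then show ?thesis using m(1) uvw k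
        by (intro mult[of "var_exp u + var_exp v + var_exp w"])
          (auto simp: lookup_add lookup_single when_def in_keys_iff)
    qed
  qed
  show "coeff_ideal (verts G) (standard_monomials G) \<subseteq> (graph_ideal G :: ('a, 'k) mpoly set)"
  proof
    fix p :: "('a, 'k) mpoly" assume p: "p \<in> coeff_ideal (verts G) (standard_monomials G)"
    \<comment> \<open>All terms of \<open>p\<close> are nonstandard. The partial sums of its terms
      are added up one term at a time.\<close>
    have "(\<Sum>m\<in>S. Poly_Mapping.single m (lookup p m)) \<in> graph_ideal G"
      if "finite S" "S \<subseteq> Poly_Mapping.keys p" for S
      using that
    proof (induction S)
      case empty
      show ?case using I.zero_closed by (simp add: mpoly_ring_simps)
    next
      case (insert m S)
      then have "Poly_Mapping.single m (lookup p m) \<in> graph_ideal G"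
        using p by (intro nonstd) (auto simp: coeff_ideal_def carrier_mpoly_ring in_keys_iff)
      with insert show ?case using I.a_closed by (simp add: mpoly_ring_simps)
    qed
    then show "p \<in> graph_ideal G"
      by (subst poly_mapping_sum_single[of "Poly_Mapping.keys p"]) auto
  qed
qed

section \<open>Coordinates on the algebra of a graph\<close>

abbreviation polys :: "('a, 'k::field) mpoly set"
  where "polys \<equiv> carrier (mpoly_ring (verts G))"

abbreviation algebra_of :: "('k::field, ('a, 'k) mpoly set) module" (\<open>\<A>\<close>)
  where "algebra_of \<equiv> graph_algebra G"

lemma ideal_graph_ideal: "ideal (graph_ideal G :: ('a, 'k::field) mpoly set) (mpoly_ring (verts G))"
  unfolding graph_ideal_eq by (rule ideal_coeff_ideal) (rule standard_monomials_divisor)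

lemma graph_algebra_simps:
  "carrier \<A> = carrier (mpoly_ring (verts G) Quot graph_ideal G)"
  "monoid.mult \<A> = monoid.mult (mpoly_ring (verts G) Quot graph_ideal G)"
  "add \<A> = add (mpoly_ring (verts G) Quot graph_ideal G)"
  "one \<A> = one (mpoly_ring (verts G) Quot graph_ideal G)"
  "ring.zero \<A> = ring.zero (mpoly_ring (verts G) Quot graph_ideal G)"
  "module.smult \<A> c a = residue_class G (mpoly_const c) \<otimes>\<^bsub>\<A>\<^esub> a"
  by (simp_all add: graph_algebra_def Let_def)

lemma cring_graph_algebra: "cring (\<A> :: ('k::field, _) module)"
proof -
  interpret I: ideal "graph_ideal G :: ('a, 'k) mpoly set" "mpoly_ring (verts G)"
    by (rule ideal_graph_ideal)
  interpret Q: cring "mpoly_ring (verts G) Quot (graph_ideal G :: ('a, 'k) mpoly set)"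
    by (rule I.quotient_is_cring[OF cring_mpoly_ring])
  show ?thesis
  proof (rule cringI)
    show "abelian_group (\<A> :: ('k, _) module)"
      by (rule abelian_groupI)
        (auto simp: graph_algebra_simps Q.a_ac intro: Q.add.l_inv_ex)
    show "comm_monoid (\<A> :: ('k, _) module)"
      by (rule comm_monoidI) (auto simp: graph_algebra_simps Q.m_ac)
  qed (simp add: graph_algebra_simps Q.l_distr)
qed

lemma residue_class_hom: "residue_class G \<in> ring_hom (mpoly_ring (verts G)) (\<A> :: ('k::field, _) module)"
proof -
  interpret I: ideal "graph_ideal G :: ('a, 'k) mpoly set" "mpoly_ring (verts G)"
    by (rule ideal_graph_ideal)
  show ?thesis
    using I.rcos_ring_hom unfolding ring_hom_def residue_class_def[abs_def] graph_algebra_simps by simp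
qed

lemma residue_class_simps:
  assumes "p \<in> polys" "q \<in> polys"
  shows "residue_class G p \<oplus>\<^bsub>\<A>\<^esub> residue_class G q = residue_class G (p + q)"
    "residue_class G p \<otimes>\<^bsub>\<A>\<^esub> residue_class G q = residue_class G (p * q)"
  using ring_hom_add[OF residue_class_hom assms] ring_hom_mult[OF residue_class_hom assms]
  by (simp_all add: mpoly_ring_simps)

lemma residue_class_closed: "p \<in> polys \<Longrightarrow> residue_class G p \<in> carrier \<A>"
  by (rule ring_hom_closed[OF residue_class_hom])

lemma residue_class_zero: "residue_class G 0 = \<zero>\<^bsub>\<A>\<^esub>"
proof -
  interpret A: cring \<A> by (rule cring_graph_algebra)
  have "residue_class G 0 \<oplus>\<^bsub>\<A>\<^esub> residue_class G 0 = residue_class G 0"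
    by (simp add: residue_class_simps mpoly_carrier_closed)
  then show ?thesis
    by (metis A.add.r_cancel_one residue_class_closed mpoly_carrier_closed(1))
qed

lemma carrier_graph_algebra: "carrier \<A> = residue_class G ` polys"
  by (auto simp: graph_algebra_simps FactRing_def A_RCOSETS_def' residue_class_def)

lemma graph_algebraE:
  assumes "a \<in> carrier \<A>"
  obtains p where "p \<in> polys" "a = residue_class G p"
  using assms by (auto simp: carrier_graph_algebra)

text \<open>Classes agree when the difference lies in the ideal, and \<open>graph_ideal_eq\<close>
  reads this off from coefficients. So the standard monomials form a basis of the algebra.\<close>

lemma residue_class_eq_iff:
  assumes "p \<in> polys" "q \<in> polys"
  shows "residue_class G p = residue_class G q \<longleftrightarrow>
    (\<forall>t\<in>standard_monomials G. lookup p t = lookup (q :: ('a, 'k::field) mpoly) t)"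
proof -
  interpret R: cring "mpoly_ring (verts G) :: ('a, 'k) mpoly ring" by (rule cring_mpoly_ring)
  have "\<ominus>\<^bsub>mpoly_ring (verts G)\<^esub> q = - q"
    by (rule R.minus_equality) (use assms in \<open>auto simp: mpoly_ring_simps mpoly_carrier_closed\<close>)
  then have "p \<ominus>\<^bsub>mpoly_ring (verts G)\<^esub> q = p - q"
    by (simp add: a_minus_def mpoly_ring_simps)
  then have "residue_class G p = residue_class G q \<longleftrightarrow> p - q \<in> graph_ideal G"
    using R.quotient_eq_iff_same_a_r_cos[OF ideal_graph_ideal assms] by (simp add: residue_class_def)
  also have "\<dots> \<longleftrightarrow> (\<forall>t\<in>standard_monomials G. lookup p t = lookup q t)"
    using assms by (auto simp: graph_ideal_eq coeff_ideal_def mpoly_carrier_closed lookup_minus)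
  finally show ?thesis .
qed

text \<open>The coefficient in a chosen representative. For \<open>a\<close> in the carrier and
  standard \<open>t\<close> the choice does not affect the value, by
  \<open>residue_class_eq_iff\<close>.\<close>

definition coord :: "('a, 'k::field) mpoly set \<Rightarrow> ('a \<Rightarrow>\<^sub>0 nat) \<Rightarrow> 'k" where
  "coord a t = lookup (SOME p. p \<in> polys \<and> residue_class G p = a) t"

lemma coord_residue_class:
  assumes "p \<in> polys" "t \<in> standard_monomials G"
  shows "coord (residue_class G p) t = lookup p t"
proof -
  define q where "q = (SOME q. q \<in> polys \<and> residue_class G q = residue_class G p)"
  have "q \<in> polys \<and> residue_class G q = residue_class G p"
    unfolding q_def by (rule someI[of _ p]) (use assms in simp)
  then show ?thesis
    using assms residue_class_eq_iff[of q p] by (simp add: coord_def q_def)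
qed

lemma coord_eqI:
  assumes "a \<in> carrier \<A>" "b \<in> carrier \<A>"
    "\<And>t. t \<in> standard_monomials G \<Longrightarrow> coord a t = coord b t"
  shows "a = b"
proof -
  obtain p q where "p \<in> polys" "q \<in> polys" "a = residue_class G p" "b = residue_class G q"
    using assms by (meson graph_algebraE)
  then show ?thesis
    using assms(3) by (simp add: residue_class_eq_iff coord_residue_class)
qed

lemma coord_add:
  assumes "a \<in> carrier \<A>" "b \<in> carrier \<A>" "t \<in> standard_monomials G"
  shows "coord (a \<oplus>\<^bsub>\<A>\<^esub> b) t = coord a t + coord b t"
  using assms
  by (auto simp: carrier_graph_algebra residue_class_simps coord_residue_class lookup_add mpoly_carrier_closed)

lemma coord_zero:
  assumes "t \<in> standard_monomials G"
  shows "coord \<zero>\<^bsub>\<A>\<^esub> t = 0"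
  using assms coord_residue_class[of 0 t] by (simp add: residue_class_zero mpoly_carrier_closed)

text \<open>The factors come from representing polynomials. As divisors of \<open>t\<close> they are
  standard, so coefficients at them are coordinates.\<close>

lemma coord_mult_nonzeroE:
  assumes "a \<in> carrier \<A>" "b \<in> carrier \<A>" "t \<in> standard_monomials G" "coord (a \<otimes>\<^bsub>\<A>\<^esub> b) t \<noteq> 0"
  obtains u v where "t = u + v" "coord a u \<noteq> 0" "coord b v \<noteq> 0"
proof -
  obtain p q where pq: "p \<in> polys" "q \<in> polys" "a = residue_class G p" "b = residue_class G q"
    using assms by (auto simp: carrier_graph_algebra)
  then have "lookup (p * q) t \<noteq> 0"
    using assms by (simp add: residue_class_simps coord_residue_class mpoly_carrier_closed)
  then obtain u v where uv: "t = u + v" "lookup p u \<noteq> 0" "lookup q v \<noteq> 0"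
    by (rule lookup_mult_nonzeroE)
  then have "u \<in> standard_monomials G" "v \<in> standard_monomials G"
    using assms(3) standard_monomials_divisor standard_monomials_divisor' by blast+
  then show ?thesis using that uv pq by (simp add: coord_residue_class)
qed

section \<open>Classes of monomials and the scalar action\<close>

definition monom_class :: "'k::field \<Rightarrow> ('a \<Rightarrow>\<^sub>0 nat) \<Rightarrow> ('a, 'k) mpoly set" where
  "monom_class c s = residue_class G (Poly_Mapping.single s c)"

lemma residue_class_var: "residue_class G (mpoly_var v) = monom_class 1 (var_exp v)"
  by (simp add: monom_class_def mpoly_var_def)

lemma standard_keys: "s \<in> standard_monomials G \<Longrightarrow> Poly_Mapping.keys s \<subseteq> verts G"
  by (simp add: standard_monomials_def)

lemma monom_class_closed: "Poly_Mapping.keys s \<subseteq> verts G \<Longrightarrow> monom_class c s \<in> carrier \<A>"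
  by (simp add: monom_class_def residue_class_closed mpoly_carrier_closed)

lemma coord_monom_class:
  assumes "Poly_Mapping.keys s \<subseteq> verts G" "t \<in> standard_monomials G"
  shows "coord (monom_class c s) t = (if s = t then c else 0)"
  using assms by (simp add: monom_class_def coord_residue_class mpoly_carrier_closed lookup_single when_def)

lemma monom_class_nonstandard:
  assumes "Poly_Mapping.keys s \<subseteq> verts G" "s \<notin> standard_monomials G"
  shows "monom_class c s = \<zero>\<^bsub>\<A>\<^esub>"
proof -
  interpret A: cring \<A> by (rule cring_graph_algebra)
  show ?thesis
    using assms by (intro coord_eqI) (auto simp: monom_class_closed coord_monom_class coord_zero)
qed

lemma monom_class_mult:
  assumes "Poly_Mapping.keys s \<subseteq> verts G" "Poly_Mapping.keys t \<subseteq> verts G"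
  shows "monom_class c s \<otimes>\<^bsub>\<A>\<^esub> monom_class d t = monom_class (c * d) (s + t)"
  using assms by (simp add: monom_class_def residue_class_simps mpoly_carrier_closed mult_single)

lemma coord_monom_mult:
  assumes "Poly_Mapping.keys s \<subseteq> verts G" "a \<in> carrier \<A>" "s + t \<in> standard_monomials G"
  shows "coord (monom_class c s \<otimes>\<^bsub>\<A>\<^esub> a) (s + t) = c * coord a t"
proof -
  obtain p where p: "p \<in> polys" "a = residue_class G p" using assms(2) by (rule graph_algebraE)
  moreover have "t \<in> standard_monomials G" using assms(3) by (rule standard_monomials_divisor')
  ultimately show ?thesis
    using assms by (simp add: monom_class_def residue_class_simps coord_residue_class mpoly_carrier_closed
        lookup_single_mult)
qed

lemma coord_monom_mult_eq_zero:
  assumes "Poly_Mapping.keys s \<subseteq> verts G" "a \<in> carrier \<A>" "t \<in> standard_monomials G"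
    and "\<And>u. t \<noteq> s + u"
  shows "coord (monom_class c s \<otimes>\<^bsub>\<A>\<^esub> a) t = 0"
proof (rule ccontr)
  assume "coord (monom_class c s \<otimes>\<^bsub>\<A>\<^esub> a) t \<noteq> 0"
  then obtain u v where uv: "t = u + v" "coord (monom_class c s) u \<noteq> 0"
    using assms by (meson coord_mult_nonzeroE monom_class_closed)
  moreover have "u \<in> standard_monomials G"
    using assms(3) uv(1) standard_monomials_divisor by blast
  ultimately show False using assms by (auto simp: coord_monom_class split: if_splits)
qed

text \<open>Scalars are constants of the algebra, so facts on scalar multiples are instances of
  facts on monomial multiples with exponent \<open>0\<close>.\<close>

lemma smult_eq_mult: "c \<odot>\<^bsub>\<A>\<^esub> a = monom_class c 0 \<otimes>\<^bsub>\<A>\<^esub> a"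
  by (simp add: graph_algebra_simps(6) mpoly_const_def monom_class_def)

lemma smult_closed: "a \<in> carrier \<A> \<Longrightarrow> c \<odot>\<^bsub>\<A>\<^esub> a \<in> carrier \<A>"
proof -
  interpret A: cring \<A> by (rule cring_graph_algebra)
  show "a \<in> carrier \<A> \<Longrightarrow> c \<odot>\<^bsub>\<A>\<^esub> a \<in> carrier \<A>"
    by (simp add: smult_eq_mult monom_class_closed)
qed

lemma coord_smult:
  assumes "a \<in> carrier \<A>" "t \<in> standard_monomials G"
  shows "coord (c \<odot>\<^bsub>\<A>\<^esub> a) t = c * coord a t"
  using coord_monom_mult[of 0 a t c] assms by (simp add: smult_eq_mult)

definition of_coords :: "(('a \<Rightarrow>\<^sub>0 nat) \<Rightarrow> 'k::field) \<Rightarrow> ('a, 'k) mpoly set" where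
  "of_coords g = residue_class G (\<Sum>s\<in>standard_monomials G. Poly_Mapping.single s (g s))"

lemma sum_polys: "(\<And>s. s \<in> S \<Longrightarrow> f s \<in> polys) \<Longrightarrow> sum f S \<in> polys"
  by (induction S rule: infinite_finite_induct) (auto simp: mpoly_carrier_closed)

lemma of_coords_closed: "of_coords g \<in> carrier \<A>"
  unfolding of_coords_def by (intro residue_class_closed sum_polys mpoly_carrier_closed(7) standard_keys)

lemma coord_of_coords:
  assumes "t \<in> standard_monomials G"
  shows "coord (of_coords g) t = g t"
proof -
  have "coord (of_coords g) t = (\<Sum>s\<in>standard_monomials G. lookup (Poly_Mapping.single s (g s)) t)"
    unfolding of_coords_def using assms
    by (subst coord_residue_class) (auto simp: lookup_sum intro!: sum_polys mpoly_carrier_closed(7) dest: standard_keys)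
  also have "\<dots> = g t"
    using assms finite_standard_monomials by (simp add: lookup_single when_def)
  finally show ?thesis .
qed

lemma of_coords_coord: "a \<in> carrier \<A> \<Longrightarrow> of_coords (coord a) = a"
  by (rule coord_eqI) (auto simp: of_coords_closed coord_of_coords)

text \<open>Each element is the finite sum of its standard terms. The equation
  \<open>coord a s = c\<close> refers to the original \<open>a\<close>, so that knowledge about its
  coordinates remains available in the monomial case.\<close>

lemma monom_sum_induct [consumes 1, case_names zero monom add]:
  assumes "a \<in> carrier (\<A> :: ('k::field, _) module)"
    and "P \<zero>\<^bsub>\<A>\<^esub>"
    and "\<And>s c. s \<in> standard_monomials G \<Longrightarrow> coord a s = c \<Longrightarrow> P (monom_class c s)"
    and "\<And>x y. x \<in> carrier \<A> \<Longrightarrow> y \<in> carrier \<A> \<Longrightarrow> P x \<Longrightarrow> P y \<Longrightarrow> P (x \<oplus>\<^bsub>\<A>\<^esub> y)"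
  shows "P a"
proof -
  \<comment> \<open>Partial sums of \<open>a\<close> over sets \<open>S\<close> of standard
    monomials; the full set returns \<open>a\<close> by \<open>of_coords_coord\<close>.\<close>
  have "P (residue_class G (\<Sum>s\<in>S. Poly_Mapping.single s (coord a s)))"
    if "finite S" "S \<subseteq> standard_monomials G" for S
    using that
  proof (induction S)
    case empty
    show ?case using assms(2) by (simp add: residue_class_zero)
  next
    case (insert m S)
    have m: "Poly_Mapping.single m (coord a m) \<in> polys"
      using insert by (auto intro: mpoly_carrier_closed dest: standard_keys)
    have S: "(\<Sum>s\<in>S. Poly_Mapping.single s (coord a s)) \<in> polys"
      using insert by (auto intro!: mpoly_carrier_closed sum_polys dest: standard_keys)
    have "P (monom_class (coord a m) m \<oplus>\<^bsub>\<A>\<^esub> residue_class G (\<Sum>s\<in>S. Poly_Mapping.single s (coord a s)))"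
      using insert m S by (intro assms(3,4)) (auto simp: residue_class_closed monom_class_def)
    then show ?case
      using insert m S by (simp add: monom_class_def residue_class_simps)
  qed
  from this[OF finite_standard_monomials] show ?thesis
    using of_coords_coord[OF assms(1)] by (simp add: of_coords_def)
qed

text \<open>The span of the standard monomials in \<open>T\<close>. With \<open>UNIV\<close> this is
  the whole algebra, with \<open>- {0}\<close> the span of the standard monomials of positive
  degree.\<close>

definition coord_subspace :: "('a \<Rightarrow>\<^sub>0 nat) set \<Rightarrow> ('a, 'k::field) mpoly set set" where
  "coord_subspace T = {a \<in> carrier \<A>. \<forall>t\<in>standard_monomials G - T. coord a t = 0}"

lemma coord_subspaceI:
  "a \<in> carrier \<A> \<Longrightarrow> (\<And>t. t \<in> standard_monomials G \<Longrightarrow> t \<notin> T \<Longrightarrow> coord a t = 0) \<Longrightarrow> a \<in> coord_subspace T"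
  by (simp add: coord_subspace_def)

lemma coord_subspace_carrier: "a \<in> coord_subspace T \<Longrightarrow> a \<in> carrier \<A>"
  by (simp add: coord_subspace_def)

lemma coord_subspaceD:
  "a \<in> coord_subspace T \<Longrightarrow> t \<in> standard_monomials G \<Longrightarrow> t \<notin> T \<Longrightarrow> coord a t = 0"
  by (simp add: coord_subspace_def)

text \<open>A nonzero coordinate of a product at \<open>t\<close> makes \<open>t\<close> a multiple
  of a monomial occurring in the first factor, hence of one in \<open>T\<close>, so \<open>t\<close>
  is itself in \<open>T\<close>.\<close>

lemma ideal_coord_subspace:
  assumes "\<And>s t. s + t \<in> standard_monomials G \<Longrightarrow> s \<in> T \<Longrightarrow> s + t \<in> T"
  shows "ideal (coord_subspace T :: ('a, 'k::field) mpoly set set) \<A>"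
proof -
  interpret A: cring "\<A> :: ('k, ('a, 'k) mpoly set) module" by (rule cring_graph_algebra)
  have mult: "a \<otimes>\<^bsub>\<A>\<^esub> b \<in> coord_subspace T"
    if "a \<in> coord_subspace T" "b \<in> carrier \<A>" for a b :: "('a, 'k) mpoly set"
  proof -
    have "coord (a \<otimes>\<^bsub>\<A>\<^esub> b) t = 0" if t: "t \<in> standard_monomials G - T" for t
    proof (rule ccontr)
      assume "coord (a \<otimes>\<^bsub>\<A>\<^esub> b) t \<noteq> 0"
      then obtain u v where uv: "t = u + v" "coord a u \<noteq> 0"
        using \<open>a \<in> coord_subspace T\<close> \<open>b \<in> carrier \<A>\<close> t
        by (auto simp: coord_subspace_def elim: coord_mult_nonzeroE)
      then have "u \<in> T"
        using \<open>a \<in> coord_subspace T\<close> t standard_monomials_divisor by (auto simp: coord_subspace_def)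
      then show False using assms uv t by auto
    qed
    then show ?thesis using that by (simp add: coord_subspace_def)
  qed
  have minus: "coord (\<ominus>\<^bsub>\<A>\<^esub> a) t = - coord a t"
    if "a \<in> carrier \<A>" "t \<in> standard_monomials G" for a :: "('a, 'k) mpoly set" and t
    using coord_add[of a "\<ominus>\<^bsub>\<A>\<^esub> a" t] that by (simp add: A.r_neg coord_zero eq_neg_iff_add_eq_0 add.commute)
  show ?thesis
  proof (rule idealI)
    show "subgroup (coord_subspace T :: ('a, 'k) mpoly set set) (add_monoid \<A>)"
      by (rule A.add.subgroupI)
        (auto simp: coord_subspace_def coord_add minus intro: exI[of _ "\<zero>\<^bsub>\<A>\<^esub>"] coord_zero)
    show "ring (\<A> :: ('k, ('a, 'k) mpoly set) module)" by (rule A.ring_axioms)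
    show "a \<otimes>\<^bsub>\<A>\<^esub> x \<in> coord_subspace T" if "a \<in> coord_subspace T" "x \<in> carrier \<A>" for a x :: "('a, 'k) mpoly set"
      using that by (rule mult)
    show "x \<otimes>\<^bsub>\<A>\<^esub> a \<in> coord_subspace T" if "a \<in> coord_subspace T" "x \<in> carrier \<A>" for a x :: "('a, 'k) mpoly set"
      using mult[OF that] that by (simp add: A.m_comm coord_subspace_def)
  qed
qed

section \<open>Coordinates on the canonical module\<close>

abbreviation canonical_of :: "(('a, 'k::field) mpoly set, ('a, 'k) mpoly set \<Rightarrow> 'k) module" (\<open>\<W>\<close>)
  where "canonical_of \<equiv> canonical_module ring_of_type_algebra \<A>"

abbreviation "canonical_homs \<equiv> mod_hom \<A> \<W> (regular_module \<A>)"

lemma canonical_module_simps: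
  "ring.zero \<W> = (\<lambda>x\<in>carrier \<A>. 0)"
  "f \<oplus>\<^bsub>\<W>\<^esub> g = (\<lambda>x\<in>carrier \<A>. f x + g x)"
  "a \<odot>\<^bsub>\<W>\<^esub> f = (\<lambda>b\<in>carrier \<A>. f (a \<otimes>\<^bsub>\<A>\<^esub> b))"
  by (simp_all add: canonical_module_def ring_of_type_algebra_def)

lemma carrier_canonical_module:
  "f \<in> carrier \<W> \<longleftrightarrow> f \<in> extensional (carrier \<A>) \<and>
     (\<forall>x\<in>carrier \<A>. \<forall>y\<in>carrier \<A>. f (x \<oplus>\<^bsub>\<A>\<^esub> y) = f x + f y) \<and>
     (\<forall>c. \<forall>x\<in>carrier \<A>. f (c \<odot>\<^bsub>\<A>\<^esub> x) = c * f x)"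
  by (simp add: canonical_module_def mod_hom_def regular_module_def ring_of_type_algebra_def PiE_def)

lemma canonical_module_add_closed:
  assumes "f \<in> carrier \<W>" "g \<in> carrier \<W>"
  shows "f \<oplus>\<^bsub>\<W>\<^esub> g \<in> carrier \<W>"
proof -
  interpret A: cring \<A> by (rule cring_graph_algebra)
  show ?thesis
    using assms by (simp add: carrier_canonical_module canonical_module_simps smult_closed algebra_simps)
qed

lemma canonical_module_smult_closed:
  assumes "f \<in> carrier \<W>" "a \<in> carrier \<A>"
  shows "a \<odot>\<^bsub>\<W>\<^esub> f \<in> carrier \<W>"
proof -
  interpret A: cring \<A> by (rule cring_graph_algebra)
  have "a \<otimes>\<^bsub>\<A>\<^esub> (c \<odot>\<^bsub>\<A>\<^esub> x) = c \<odot>\<^bsub>\<A>\<^esub> (a \<otimes>\<^bsub>\<A>\<^esub> x)" if "x \<in> carrier \<A>" for c x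
    using that assms by (simp add: smult_eq_mult A.m_lcomm monom_class_closed)
  then show ?thesis
    using assms by (simp add: carrier_canonical_module canonical_module_simps smult_closed A.r_distr)
qed

lemma canonical_zero_arg:
  assumes "f \<in> carrier \<W>"
  shows "f \<zero>\<^bsub>\<A>\<^esub> = 0"
proof -
  interpret A: cring \<A> by (rule cring_graph_algebra)
  have "f (\<zero>\<^bsub>\<A>\<^esub> \<oplus>\<^bsub>\<A>\<^esub> \<zero>\<^bsub>\<A>\<^esub>) = f \<zero>\<^bsub>\<A>\<^esub> + f \<zero>\<^bsub>\<A>\<^esub>"
    using assms by (simp add: carrier_canonical_module del: A.r_zero A.l_zero)
  then show ?thesis by (metis A.l_zero A.zero_closed add_cancel_right_right)
qed

lemma canonical_monom_class:
  assumes "f \<in> carrier \<W>" "Poly_Mapping.keys s \<subseteq> verts G"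
  shows "f (monom_class c s) = c * f (monom_class 1 s)"
proof -
  have "monom_class c s = c \<odot>\<^bsub>\<A>\<^esub> monom_class 1 s"
    using assms(2) by (simp add: smult_eq_mult monom_class_mult)
  then show ?thesis
    using assms by (simp add: carrier_canonical_module monom_class_closed)
qed

text \<open>A linear functional is determined on a basis, and extensionality settles arguments
  outside the carrier.\<close>

lemma canonical_eqI:
  assumes "f \<in> carrier (\<W> :: (_, _ \<Rightarrow> 'k::field) module)" "g \<in> carrier \<W>"
    and "\<And>s. s \<in> standard_monomials G \<Longrightarrow> f (monom_class 1 s) = g (monom_class 1 s)"
  shows "f = g"
proof
  fix a :: "('a, 'k) mpoly set"
  show "f a = g a"
  proof (cases "a \<in> carrier \<A>")
    case True
    then show ?thesis
    proof (induction rule: monom_sum_induct)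
      case zero show ?case using assms by (simp add: canonical_zero_arg)
    next
      case (monom s c)
      then show ?case using assms by (simp add: canonical_monom_class[of _ s c] standard_keys)
    next
      case (add x y) then show ?case using assms by (simp add: carrier_canonical_module)
    qed
  next
    case False
    then show ?thesis using assms by (auto simp: carrier_canonical_module extensional_def)
  qed
qed

text \<open>The linear functional with value \<open>g s\<close> at the standard monomial
  \<open>s\<close>, that is, the element of the dual space with coordinates \<open>g\<close> in the
  dual basis.\<close>

definition functional :: "(('a \<Rightarrow>\<^sub>0 nat) \<Rightarrow> 'k::field) \<Rightarrow> ('a, 'k) mpoly set \<Rightarrow> 'k" where
  "functional g = (\<lambda>a\<in>carrier \<A>. \<Sum>s\<in>standard_monomials G. g s * coord a s)"

lemma functional_closed: "functional g \<in> carrier \<W>"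
proof -
  interpret A: cring \<A> by (rule cring_graph_algebra)
  show ?thesis
    by (auto simp: carrier_canonical_module functional_def smult_closed coord_add coord_smult
        distrib_left sum.distrib sum_distrib_left mult.left_commute)
qed

lemma functional_monom_class:
  assumes "s \<in> standard_monomials G"
  shows "functional g (monom_class c s) = g s * c"
proof -
  have "functional g (monom_class c s) = (\<Sum>r\<in>standard_monomials G. if s = r then g r * c else 0)"
    using assms by (auto simp: functional_def coord_monom_class monom_class_closed standard_keys intro!: sum.cong)
  then show ?thesis
    using assms finite_standard_monomials by simp
qed

lemma functional_coords:
  assumes "f \<in> carrier \<W>"
  shows "f = functional (\<lambda>s. f (monom_class 1 s))"
  by (rule canonical_eqI) (simp_all add: assms functional_closed functional_monom_class)

lemma functional_add: "functional g \<oplus>\<^bsub>\<W>\<^esub> functional h = functional (\<lambda>s. g s + h s)"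
  by (rule canonical_eqI)
    (simp_all add: canonical_module_add_closed functional_closed,
     simp add: canonical_module_simps functional_monom_class monom_class_closed standard_keys)

text \<open>The transpose of multiplication by a monomial: the product of the classes of
  \<open>m\<close> and \<open>s\<close> is the class of \<open>m + s\<close>, which vanishes unless
  \<open>m + s\<close> is standard.\<close>

lemma functional_smult:
  assumes "Poly_Mapping.keys m \<subseteq> verts G"
  shows "monom_class c m \<odot>\<^bsub>\<W>\<^esub> functional g =
    functional (\<lambda>s. if m + s \<in> standard_monomials G then c * g (m + s) else 0)"
proof (rule canonical_eqI)
  fix s assume s: "s \<in> standard_monomials G"
  have "monom_class c m \<otimes>\<^bsub>\<A>\<^esub> monom_class 1 s = monom_class c (m + s)"
    using assms s by (simp add: monom_class_mult standard_keys)
  moreover have "monom_class c (m + s) = \<zero>\<^bsub>\<A>\<^esub>" if "m + s \<notin> standard_monomials G"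
    using that assms s by (intro monom_class_nonstandard) (auto simp: keys_add_nat dest: standard_keys)
  ultimately show "(monom_class c m \<odot>\<^bsub>\<W>\<^esub> functional g) (monom_class 1 s) =
    functional (\<lambda>s. if m + s \<in> standard_monomials G then c * g (m + s) else 0) (monom_class 1 s)"
    using s by (auto simp: canonical_module_simps monom_class_closed standard_keys functional_monom_class
        canonical_zero_arg functional_closed)
qed (simp_all add: canonical_module_smult_closed functional_closed monom_class_closed assms)

lemma canonical_homs_iff:
  "\<phi> \<in> canonical_homs \<longleftrightarrow> \<phi> \<in> carrier \<W> \<rightarrow>\<^sub>E carrier \<A> \<and>
    (\<forall>f\<in>carrier \<W>. \<forall>g\<in>carrier \<W>. \<phi> (f \<oplus>\<^bsub>\<W>\<^esub> g) = \<phi> f \<oplus>\<^bsub>\<A>\<^esub> \<phi> g) \<and>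
    (\<forall>a\<in>carrier \<A>. \<forall>f\<in>carrier \<W>. \<phi> (a \<odot>\<^bsub>\<W>\<^esub> f) = a \<otimes>\<^bsub>\<A>\<^esub> \<phi> f)"
  by (simp add: mod_hom_def regular_module_def)

section \<open>Homomorphisms attached to a monomial\<close>

text \<open>
  Rigidity of \<open>N\<close> is the condition that makes pairing along the factorizations of \<open>N\<close> linear
  over the algebra: since standard monomials are squarefree, in \<open>st = Nm\<close> the factor \<open>m\<close> then divides
  both \<open>s\<close> and \<open>t\<close>.
\<close>

definition rigid :: "('a \<Rightarrow>\<^sub>0 nat) \<Rightarrow> bool" where
  "rigid N \<longleftrightarrow> (\<forall>s\<in>standard_monomials G. \<forall>t\<in>standard_monomials G. \<forall>u.
     s + t = N + u \<longrightarrow> Poly_Mapping.keys u \<subseteq> Poly_Mapping.keys N)"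

text \<open>Where \<open>m\<close> has a positive exponent, so has \<open>N\<close> by rigidity. The
  exponents of \<open>s\<close> and \<open>t\<close> there are at most 1 and add up to at least 2,
  so both equal 1, and so does that of \<open>m\<close>.\<close>

lemma rigid_divisor:
  assumes "rigid N" "s \<in> standard_monomials G" "t \<in> standard_monomials G" "s + t = N + m"
  obtains u where "t = m + u"
proof (rule monomial_dvdE)
  fix v
  have "lookup s v \<le> 1" "lookup t v \<le> 1"
    using assms(2,3) by (auto simp: standard_monomials_def)
  moreover have "lookup s v + lookup t v = lookup N v + lookup m v"
    using arg_cong[OF assms(4), of "\<lambda>x. lookup x v"] by (simp add: lookup_add)
  moreover have "lookup m v \<noteq> 0 \<Longrightarrow> lookup N v \<noteq> 0"
    using assms unfolding rigid_def by (metis in_keys_iff subsetD)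
  ultimately show "lookup m v \<le> lookup t v" by linarith
qed (use that in blast)

text \<open>Evaluation of \<open>f\<close> at the cofactor of \<open>t\<close> in \<open>N\<close>.
  Exponent subtraction is truncated, and the guard ensures that \<open>N - t\<close> is a genuine,
  standard cofactor.\<close>

definition pairing_coord :: "('a \<Rightarrow>\<^sub>0 nat) \<Rightarrow> (('a, 'k::field) mpoly set \<Rightarrow> 'k) \<Rightarrow> ('a \<Rightarrow>\<^sub>0 nat) \<Rightarrow> 'k" where
  "pairing_coord N f t = (if \<exists>s\<in>standard_monomials G. s + t = N then f (monom_class 1 (N - t)) else 0)"

definition pairing_hom :: "('a \<Rightarrow>\<^sub>0 nat) \<Rightarrow> (('a, 'k::field) mpoly set \<Rightarrow> 'k) \<Rightarrow> ('a, 'k) mpoly set" where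
  "pairing_hom N = (\<lambda>f\<in>carrier \<W>. of_coords (pairing_coord N f))"

text \<open>Let \<open>t = m + t'\<close>. Rigidity makes \<open>m\<close> divide any standard
  cofactor of \<open>t'\<close>, and the quotient is the cofactor of \<open>t\<close>, so both sides
  evaluate \<open>f\<close> at the same monomial. If \<open>m\<close> does not divide
  \<open>t\<close>, the right side is 0; by rigidity \<open>m\<close> times a cofactor of
  \<open>t\<close> is nonstandard, so the left side is 0 too.\<close>

lemma pairing_coord_smult:
  assumes "rigid N" "f \<in> carrier \<W>" "m \<in> standard_monomials G" "t \<in> standard_monomials G"
  shows "pairing_coord N (monom_class c m \<odot>\<^bsub>\<W>\<^esub> f) t =
    coord (monom_class c m \<otimes>\<^bsub>\<A>\<^esub> of_coords (pairing_coord N f)) t"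
proof -
  have act: "(monom_class c m \<odot>\<^bsub>\<W>\<^esub> f) (monom_class 1 s) =
      (if m + s \<in> standard_monomials G then c * f (monom_class 1 (m + s)) else 0)"
    if "s \<in> standard_monomials G" for s
    using that assms
    by (subst functional_coords[OF assms(2)])
      (simp add: functional_smult standard_keys functional_monom_class)
  show ?thesis
  proof (cases "\<exists>u. t = m + u")
    case True
    then obtain t' where t': "t = m + t'" by blast
    then have std: "t' \<in> standard_monomials G"
      using assms(4) standard_monomials_divisor' by blast
    have rhs: "coord (monom_class c m \<otimes>\<^bsub>\<A>\<^esub> of_coords (pairing_coord N f)) t = c * pairing_coord N f t'"
      using assms std unfolding t'
      by (simp add: coord_monom_mult standard_keys of_coords_closed coord_of_coords)
    show ?thesis
    proof (cases "\<exists>s\<in>standard_monomials G. s + t' = N")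
      case True
      then obtain s where s: "s \<in> standard_monomials G" "s + t' = N" by blast
      then have "t + s = N + m" by (simp add: t' ac_simps)
      then obtain s' where s': "s = m + s'"
        using rigid_divisor[OF assms(1,4) s(1)] by blast
      then have std': "s' \<in> standard_monomials G"
        using s(1) standard_monomials_divisor' by blast
      have N: "N = s' + t" using s(2) s' t' by (simp add: ac_simps)
      have "N - t = s'" "N - t' = s" using N s(2) by (metis add_diff_cancel_right')+
      then show ?thesis
        using N s s' std' act[OF std'] unfolding rhs by (auto simp: pairing_coord_def)
    next
      case False
      have "(monom_class c m \<odot>\<^bsub>\<W>\<^esub> f) (monom_class 1 (N - t)) = 0"
        if "s \<in> standard_monomials G" "s + t = N" for s
      proof -
        have "(m + s) + t' = N" using that t' by (simp add: ac_simps)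
        then have "m + s \<notin> standard_monomials G" using False by blast
        moreover have "N - t = s" using that(2) by auto
        ultimately show ?thesis using act[OF that(1)] by simp
      qed
      then show ?thesis using False unfolding rhs by (auto simp: pairing_coord_def)
    qed
  next
    case False
    have "(monom_class c m \<odot>\<^bsub>\<W>\<^esub> f) (monom_class 1 (N - t)) = 0"
      if s: "s \<in> standard_monomials G" "s + t = N" for s
    proof -
      have "m + s \<notin> standard_monomials G"
      proof
        assume "m + s \<in> standard_monomials G"
        moreover have "(m + s) + t = N + m" using s by (simp add: ac_simps)
        ultimately show False using rigid_divisor[OF assms(1) _ assms(4)] False by blast
      qed
      moreover have "N - t = s" using s(2) by auto
      ultimately show ?thesis using act[OF s(1)] by simp
    qed
    then show ?thesis
      using False assms by (auto simp: pairing_coord_def coord_monom_mult_eq_zero standard_keys of_coords_closed)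
  qed
qed

lemma pairing_hom_closed: "f \<in> carrier \<W> \<Longrightarrow> pairing_hom N f \<in> carrier \<A>"
  by (simp add: pairing_hom_def of_coords_closed)

lemma coord_pairing_hom:
  "f \<in> carrier \<W> \<Longrightarrow> t \<in> standard_monomials G \<Longrightarrow> coord (pairing_hom N f) t = pairing_coord N f t"
  by (simp add: pairing_hom_def coord_of_coords)

lemma pairing_hom_add:
  assumes "f \<in> carrier \<W>" "g \<in> carrier \<W>"
  shows "pairing_hom N (f \<oplus>\<^bsub>\<W>\<^esub> g) = pairing_hom N f \<oplus>\<^bsub>\<A>\<^esub> pairing_hom N g"
proof -
  interpret A: cring \<A> by (rule cring_graph_algebra)
  have "pairing_coord N (f \<oplus>\<^bsub>\<W>\<^esub> g) t = pairing_coord N f t + pairing_coord N g t" for t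
    by (auto simp: pairing_coord_def canonical_module_simps monom_class_closed standard_keys)
  then show ?thesis
    using assms
    by (intro coord_eqI)
      (auto simp: pairing_hom_closed canonical_module_add_closed coord_pairing_hom coord_add)
qed

text \<open>Additivity reduces linearity over the algebra to multiplication by a single monomial,
  which is \<open>pairing_coord_smult\<close>.\<close>

lemma pairing_hom:
  assumes "rigid N"
  shows "pairing_hom N \<in> (canonical_homs :: ((_ \<Rightarrow> 'k::field) \<Rightarrow> _) set)"
proof -
  interpret A: cring "\<A> :: ('k, ('a, 'k) mpoly set) module" by (rule cring_graph_algebra)
  have smult: "pairing_hom N (a \<odot>\<^bsub>\<W>\<^esub> f) = a \<otimes>\<^bsub>\<A>\<^esub> pairing_hom N f"
    if "a \<in> carrier \<A>" and f: "f \<in> carrier \<W>" for a and f :: "('a, 'k) mpoly set \<Rightarrow> 'k"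
    using that(1)
  proof (induction rule: monom_sum_induct)
    case zero
    \<comment> \<open>An element equal to its own double is zero; this property passes from the
      functional to its image.\<close>
    have "\<zero>\<^bsub>\<A>\<^esub> \<odot>\<^bsub>\<W>\<^esub> f \<oplus>\<^bsub>\<W>\<^esub> \<zero>\<^bsub>\<A>\<^esub> \<odot>\<^bsub>\<W>\<^esub> f = \<zero>\<^bsub>\<A>\<^esub> \<odot>\<^bsub>\<W>\<^esub> f"
      using f by (auto simp: canonical_module_simps canonical_zero_arg fun_eq_iff)
    then have "pairing_hom N (\<zero>\<^bsub>\<A>\<^esub> \<odot>\<^bsub>\<W>\<^esub> f) \<oplus>\<^bsub>\<A>\<^esub> pairing_hom N (\<zero>\<^bsub>\<A>\<^esub> \<odot>\<^bsub>\<W>\<^esub> f) =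
        pairing_hom N (\<zero>\<^bsub>\<A>\<^esub> \<odot>\<^bsub>\<W>\<^esub> f)"
      using f by (metis pairing_hom_add canonical_module_smult_closed A.zero_closed)
    then show ?case
      using f by (simp add: pairing_hom_closed canonical_module_smult_closed)
  next
    case (monom s c)
    then show ?case
      using f assms pairing_coord_smult[OF assms f monom(1)]
      by (intro coord_eqI)
        (auto simp: pairing_hom_closed canonical_module_smult_closed monom_class_closed standard_keys
          coord_pairing_hom, simp add: pairing_hom_def)
  next
    case (add x y)
    have "(x \<oplus>\<^bsub>\<A>\<^esub> y) \<odot>\<^bsub>\<W>\<^esub> f = x \<odot>\<^bsub>\<W>\<^esub> f \<oplus>\<^bsub>\<W>\<^esub> y \<odot>\<^bsub>\<W>\<^esub> f"
      using f add(1,2) by (auto simp: canonical_module_simps carrier_canonical_module A.l_distr fun_eq_iff)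
    then show ?case
      using f add by (simp add: pairing_hom_add canonical_module_smult_closed A.l_distr pairing_hom_closed)
  qed
  show ?thesis
    unfolding canonical_homs_iff using smult
    by (simp add: pairing_hom_add) (simp add: pairing_hom_def restrict_PiE_iff of_coords_closed)
qed

section \<open>Bounds for the canonical trace\<close>

abbreviation trace_ideal :: "('a, 'k::field) mpoly set set"
  where "trace_ideal \<equiv> canonical_trace ring_of_type_algebra \<A>"

lemma canonical_homs_image: "\<phi> \<in> canonical_homs \<Longrightarrow> f \<in> carrier \<W> \<Longrightarrow> \<phi> f \<in> carrier \<A>"
  by (auto simp: canonical_homs_iff)

text \<open>In \<open>s + t\<close> each factor determines the other. Hence the homomorphism of
  \<open>s + t\<close> sends \<open>c\<close> times the dual vector of \<open>s\<close> to
  \<open>c\<close> times the monomial \<open>t\<close>.\<close>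

lemma monom_class_in_trace:
  assumes "s \<in> standard_monomials G" "t \<in> standard_monomials G" "rigid (s + t)"
  shows "monom_class c t \<in> trace_ideal"
proof -
  let ?f = "functional (\<lambda>r. if r = s then c else 0)"
  have "pairing_hom (s + t) ?f = monom_class c t"
  proof (rule coord_eqI)
    fix r assume r: "r \<in> standard_monomials G"
    have "coord (pairing_hom (s + t) ?f) r = pairing_coord (s + t) ?f r"
      using r by (simp add: coord_pairing_hom functional_closed)
    also have "\<dots> = (if r = t then c else 0)"
    proof (cases "\<exists>s'\<in>standard_monomials G. s' + r = s + t")
      case True
      then obtain s' where s': "s' \<in> standard_monomials G" "s' + r = s + t" by blast
      then have "s + t - r = s'" by (metis add_diff_cancel_right')
      moreover have "s' = s \<longleftrightarrow> r = t" using s'(2) by auto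
      ultimately show ?thesis using s' by (auto simp: pairing_coord_def functional_monom_class)
    next
      case False
      then show ?thesis using assms by (auto simp: pairing_coord_def)
    qed
    finally show "coord (pairing_hom (s + t) ?f) r = coord (monom_class c t) r"
      using assms r by (auto simp: coord_monom_class standard_keys)
  qed (simp_all add: assms pairing_hom_closed functional_closed monom_class_closed standard_keys)
  moreover have "pairing_hom (s + t) ?f \<in> trace_ideal"
    unfolding canonical_trace_def
    by (rule generate.incl) (use assms pairing_hom functional_closed in blast)
  ultimately show ?thesis by simp
qed

lemma trace_ideal_subset_carrier: "trace_ideal \<subseteq> carrier \<A>"
proof -
  interpret A: cring \<A> by (rule cring_graph_algebra)
  show ?thesis
    unfolding canonical_trace_def
    using A.add.generate_incl[of "\<Union>\<phi>\<in>canonical_homs. \<phi> ` carrier \<W>"] canonical_homs_image by auto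
qed

text \<open>The lower bound: the trace is closed under addition, so it suffices that it contains all
  scalar multiples of the standard monomials in \<open>T\<close>.\<close>

lemma coord_subspace_subset_trace:
  assumes "\<And>t. t \<in> standard_monomials G \<Longrightarrow> t \<in> T \<Longrightarrow> \<exists>s\<in>standard_monomials G. rigid (s + t)"
  shows "coord_subspace T \<subseteq> (trace_ideal :: ('a, 'k::field) mpoly set set)"
proof
  fix a :: "('a, 'k) mpoly set" assume a: "a \<in> coord_subspace T"
  have "\<one>\<^bsub>add_monoid \<A>\<^esub> \<in> (trace_ideal :: ('a, 'k) mpoly set set)"
    unfolding canonical_trace_def by (rule generate.one)
  then have zero_in: "\<zero>\<^bsub>\<A>\<^esub> \<in> (trace_ideal :: ('a, 'k) mpoly set set)" by simp
  have "a \<in> carrier \<A>" using a by (simp add: coord_subspace_def)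
  then show "a \<in> trace_ideal"
  proof (induction rule: monom_sum_induct)
    case zero show ?case by (rule zero_in)
  next
    case (monom s c)
    show ?case
    proof (cases "s \<in> T")
      case True
      then show ?thesis using assms monom monom_class_in_trace by blast
    next
      case False
      then have "c = 0" using a monom by (auto simp: coord_subspace_def)
      then show ?thesis using zero_in by (simp add: monom_class_def residue_class_zero)
    qed
  next
    case (add x y)
    then show ?case
      unfolding canonical_trace_def using generate.eng[of x "add_monoid \<A>" _ y] by simp
  qed
qed

text \<open>The matrix entry \<open>c(s, t)\<close> of a homomorphism \<open>\<phi>\<close> is
  \<open>coord (\<phi> (dual_basis s)) t\<close>.\<close>

abbreviation dual_basis :: "('a \<Rightarrow>\<^sub>0 nat) \<Rightarrow> ('a, 'k::field) mpoly set \<Rightarrow> 'k"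
  where "dual_basis s \<equiv> functional (\<lambda>r. if r = s then 1 else 0)"

lemma hom_zero:
  assumes "\<phi> \<in> canonical_homs"
  shows "\<phi> (functional (\<lambda>s. 0)) = \<zero>\<^bsub>\<A>\<^esub>"
proof -
  interpret A: cring \<A> by (rule cring_graph_algebra)
  have "functional (\<lambda>s. 0) \<oplus>\<^bsub>\<W>\<^esub> functional (\<lambda>s. 0) = functional (\<lambda>s. 0)"
    by (simp add: functional_add)
  then have "\<phi> (functional (\<lambda>s. 0)) \<oplus>\<^bsub>\<A>\<^esub> \<phi> (functional (\<lambda>s. 0)) = \<phi> (functional (\<lambda>s. 0))"
    using assms unfolding canonical_homs_iff by (metis functional_closed)
  then show ?thesis
    using canonical_homs_image[OF assms functional_closed] by simp
qed

text \<open>The monomial \<open>m\<close> sends the dual vector of \<open>m + s\<close> to that of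
  \<open>s\<close>, and the dual vector of a non-multiple of \<open>m\<close> to 0. Applying
  \<open>\<phi>\<close> and comparing coordinates yields the three relations, since a multiple of
  \<open>m\<close> has coordinates only at monomials divisible by \<open>m\<close>.\<close>

lemma hom_matrix_shift:
  fixes \<phi> :: "(('a, 'k::field) mpoly set \<Rightarrow> 'k) \<Rightarrow> ('a, 'k) mpoly set"
  assumes "\<phi> \<in> canonical_homs" "m + s \<in> standard_monomials G" "m + t \<in> standard_monomials G"
  shows "coord (\<phi> (dual_basis s)) (m + t) = coord (\<phi> (dual_basis (m + s))) t"
    and hom_matrix_zero_left:
    "r \<in> standard_monomials G \<Longrightarrow> (\<And>u. r \<noteq> m + u) \<Longrightarrow> coord (\<phi> (dual_basis s)) r = 0"
    and hom_matrix_zero_right: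
    "r \<in> standard_monomials G \<Longrightarrow> (\<And>u. r \<noteq> m + u) \<Longrightarrow> coord (\<phi> (dual_basis r)) t = 0"
proof -
  have keys: "Poly_Mapping.keys m \<subseteq> verts G"
    using assms(2) standard_keys by (fastforce simp: keys_add_nat)
  have act: "\<phi> (monom_class 1 m \<odot>\<^bsub>\<W>\<^esub> dual_basis r) = monom_class 1 m \<otimes>\<^bsub>\<A>\<^esub> \<phi> (dual_basis r)" for r
    using assms(1) by (simp add: canonical_homs_iff functional_closed monom_class_closed keys)
  have 1: "monom_class (1::'k) m \<odot>\<^bsub>\<W>\<^esub> dual_basis (m + s) = dual_basis s"
    using keys assms(2)
    by (intro canonical_eqI)
      (auto simp: functional_smult functional_closed functional_monom_class)
  have 2: "coord (\<phi> (dual_basis s)) r = coord (monom_class 1 m \<otimes>\<^bsub>\<A>\<^esub> \<phi> (dual_basis (m + s))) r" for r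
    using act[of "m + s"] unfolding 1 by simp
  show "coord (\<phi> (dual_basis s)) (m + t) = coord (\<phi> (dual_basis (m + s))) t"
    using assms keys by (simp add: 2 coord_monom_mult canonical_homs_image functional_closed)
  show "coord (\<phi> (dual_basis s)) r = 0" if "r \<in> standard_monomials G" "\<And>u. r \<noteq> m + u"
    using assms keys that by (simp add: 2 coord_monom_mult_eq_zero canonical_homs_image functional_closed)
  show "coord (\<phi> (dual_basis r)) t = 0" if "r \<in> standard_monomials G" "\<And>u. r \<noteq> m + u"
  proof -
    have "monom_class 1 m \<odot>\<^bsub>\<W>\<^esub> dual_basis r = functional (\<lambda>s. 0 :: 'k)"
      using keys that(2)[symmetric]
      by (intro canonical_eqI) (simp_all add: functional_smult functional_closed functional_monom_class)
    then have "monom_class 1 m \<otimes>\<^bsub>\<A>\<^esub> \<phi> (dual_basis r) = \<zero>\<^bsub>\<A>\<^esub>"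
      using act[of r] hom_zero[OF assms(1)] by simp
    then have "coord (monom_class 1 m \<otimes>\<^bsub>\<A>\<^esub> \<phi> (dual_basis r)) (m + t) = 0"
      using assms(3) by (simp add: coord_zero)
    then show ?thesis
      using assms keys by (simp add: coord_monom_mult canonical_homs_image functional_closed)
  qed
qed

text \<open>A homomorphism is determined by its matrix. Linearity over the field comes from
  linearity over the algebra, with \<open>monom_class (g r) 0\<close> in the role of the
  scalar.\<close>

lemma coord_hom:
  assumes "\<phi> \<in> canonical_homs" "t \<in> standard_monomials G"
  shows "coord (\<phi> (functional g)) t =
    (\<Sum>s\<in>standard_monomials G. g s * coord (\<phi> (dual_basis s)) t)"
proof -
  \<comment> \<open>Truncating \<open>g\<close> to a finite set \<open>S\<close> allows adding one
    dual vector at a time.\<close>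
  have "coord (\<phi> (functional (\<lambda>s. if s \<in> S then g s else 0))) t = (\<Sum>s\<in>S. g s * coord (\<phi> (dual_basis s)) t)"
    if "finite S" for S
    using that
  proof (induction S)
    case empty
    then show ?case using assms by (simp add: hom_zero coord_zero)
  next
    case (insert r S)
    have "monom_class (g r) 0 \<odot>\<^bsub>\<W>\<^esub> dual_basis r = functional (\<lambda>s. if s = r then g r else 0)"
      by (intro canonical_eqI)
        (auto simp: functional_smult functional_closed functional_monom_class)
    then have 1: "\<phi> (functional (\<lambda>s. if s = r then g r else 0)) = monom_class (g r) 0 \<otimes>\<^bsub>\<A>\<^esub> \<phi> (dual_basis r)"
      using assms(1) unfolding canonical_homs_iff
      by (metis functional_closed monom_class_closed keys_zero empty_subsetI)
    have "coord (monom_class (g r) 0 \<otimes>\<^bsub>\<A>\<^esub> \<phi> (dual_basis r)) (0 + t) = g r * coord (\<phi> (dual_basis r)) t"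
      using assms by (intro coord_monom_mult) (auto simp: canonical_homs_image functional_closed)
    then have 2: "coord (\<phi> (functional (\<lambda>s. if s = r then g r else 0))) t = g r * coord (\<phi> (dual_basis r)) t"
      using 1 by simp
    have "functional (\<lambda>s. if s \<in> insert r S then g s else 0) =
        functional (\<lambda>s. if s = r then g r else 0) \<oplus>\<^bsub>\<W>\<^esub> functional (\<lambda>s. if s \<in> S then g s else 0)"
      using insert by (auto simp: functional_add intro!: arg_cong[of _ _ functional])
    then have "\<phi> (functional (\<lambda>s. if s \<in> insert r S then g s else 0)) =
        \<phi> (functional (\<lambda>s. if s = r then g r else 0)) \<oplus>\<^bsub>\<A>\<^esub> \<phi> (functional (\<lambda>s. if s \<in> S then g s else 0))"
      using assms(1) by (simp add: canonical_homs_iff functional_closed)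
    then show ?case
      using assms insert 2 by (simp add: coord_add canonical_homs_image functional_closed)
  qed
  note * = this[OF finite_standard_monomials]
  have "functional g = functional (\<lambda>s. if s \<in> standard_monomials G then g s else 0)"
    by (auto simp: functional_def intro!: sum.cong restrict_ext)
  then show ?thesis using * by simp
qed

text \<open>The upper bound: if the matrix entries vanish for every \<open>t\<close> outside
  \<open>T\<close>, all images lie in the subspace. Being an ideal, it also contains the additive
  group they generate.\<close>

lemma trace_subset_coord_subspace:
  assumes "\<And>s t. s + t \<in> standard_monomials G \<Longrightarrow> s \<in> T \<Longrightarrow> s + t \<in> T"
    and "\<And>\<phi> s t. \<phi> \<in> (canonical_homs :: ((_ \<Rightarrow> 'k::field) \<Rightarrow> _) set) \<Longrightarrow> s \<in> standard_monomials G \<Longrightarrow>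
      t \<in> standard_monomials G \<Longrightarrow> t \<notin> T \<Longrightarrow> coord (\<phi> (dual_basis s)) t = 0"
  shows "(trace_ideal :: ('a, 'k) mpoly set set) \<subseteq> coord_subspace T"
proof -
  interpret A: cring "\<A> :: ('k, ('a, 'k) mpoly set) module" by (rule cring_graph_algebra)
  interpret H: ideal "coord_subspace T :: ('a, 'k) mpoly set set" \<A>
    by (rule ideal_coord_subspace) (rule assms(1))
  have "\<phi> f \<in> coord_subspace T" if "\<phi> \<in> canonical_homs" "f \<in> carrier \<W>"
    for \<phi> and f :: "('a, 'k) mpoly set \<Rightarrow> 'k"
  proof -
    have "coord (\<phi> f) t = 0" if "t \<in> standard_monomials G" "t \<notin> T" for t
    proof -
      have zero: "coord (\<phi> (functional (\<lambda>s. f (monom_class 1 s)))) t = 0"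
        using assms(2)[OF \<open>\<phi> \<in> canonical_homs\<close> _ that]
        by (subst coord_hom[OF \<open>\<phi> \<in> canonical_homs\<close> that(1)]) simp
      show ?thesis
        by (subst functional_coords[OF \<open>f \<in> carrier \<W>\<close>]) (rule zero)
    qed
    then show ?thesis
      unfolding coord_subspace_def using canonical_homs_image[OF that] by blast
  qed
  then have "(\<Union>\<phi>\<in>canonical_homs. \<phi> ` carrier \<W>) \<subseteq> (coord_subspace T :: ('a, 'k) mpoly set set)"
    by blast
  then show ?thesis
    unfolding canonical_trace_def
    by (rule A.add.generate_subgroup_incl[OF _ H.a_subgroup])
qed

section \<open>Triangle components\<close>

lemma arcs_ends_induce: "arcs_ends (G \<restriction> S) = {(x, y). x \<rightarrow> y \<and> x \<in> S \<and> y \<in> S}"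
  by (auto simp: arcs_ends_conv)

lemma graph_induce:
  assumes "S \<subseteq> verts G"
  shows "graph (G \<restriction> S)"
proof -
  have "induced_subgraph (G \<restriction> S) G" using assms by (rule induced_induce)
  then interpret H: digraph "G \<restriction> S" by (rule digraphI_induced)
  show ?thesis
    by unfold_locales (auto simp: symmetric_def sym_def arcs_ends_induce edge_sym)
qed

lemma scc_of_closed:
  assumes "x \<in> scc_of v" "x \<rightarrow> z"
  shows "z \<in> scc_of v"
proof -
  have "v \<rightarrow>\<^sup>* x" using assms(1) by (simp add: scc_of_def)
  then have "v \<rightarrow>\<^sup>* z" using assms(2) by (rule reachable_adj_trans)
  then show ?thesis by (rule scc_ofI_reachable')
qed

text \<open>A triangle component described through neighbourhoods alone, the form that arguments on
  matrix entries deliver. That \<open>v\<close> differs from \<open>u\<close> and \<open>w\<close>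
  follows from the absence of loops.\<close>

definition triangle_component :: "'a \<Rightarrow> 'a \<Rightarrow> 'a \<Rightarrow> bool" where
  "triangle_component v u w \<longleftrightarrow> u \<noteq> w \<and> (\<forall>z. v \<rightarrow> z \<longleftrightarrow> z \<in> {u, w}) \<and>
     (\<forall>z. u \<rightarrow> z \<longleftrightarrow> z \<in> {v, w}) \<and> (\<forall>z. w \<rightarrow> z \<longleftrightarrow> z \<in> {u, v})"

text \<open>No walk from \<open>v\<close> leaves the three vertices, and the component is closed
  under neighbours, so it consists of exactly these three.\<close>

lemma triangle_componentI:
  assumes "triangle_component v u w"
  shows "complete_digraph 3 (component G v)"
proof -
  have vuw: "v \<rightarrow> u" "v \<rightarrow> w" "u \<rightarrow> w" using assms by (auto simp: triangle_component_def)
  have "z \<in> {v, u, w}" if "v \<rightarrow>\<^sup>* z" for z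
    using that
  proof (induction rule: reachable_induct)
    case (step x y)
    then show ?case using assms unfolding triangle_component_def by blast
  qed simp
  then have "scc_of v \<subseteq> {v, u, w}" by (auto simp: scc_of_def)
  moreover have "v \<in> scc_of v"
    using vuw by (intro in_scc_of_self edge_in_verts)
  ultimately have scc: "scc_of v = {v, u, w}"
    using vuw scc_of_closed by blast
  have sub: "scc_of v \<subseteq> verts G" using vuw by (auto simp: scc edge_in_verts)
  have "v \<noteq> u" "v \<noteq> w" "u \<noteq> w" using vuw edge_neq by blast+
  then have "card (scc_of v) = 3" by (simp add: scc)
  moreover have "arcs_ends (G \<restriction> scc_of v) = {(x, y). (x, y) \<in> scc_of v \<times> scc_of v \<and> x \<noteq> y}"
    unfolding arcs_ends_induce scc using vuw edge_sym edge_neq by blast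
  ultimately show ?thesis
    unfolding component_def complete_digraph_def using graph_induce[OF sub] by simp
qed

lemma triangle_componentE:
  assumes "complete_digraph 3 (component G v)" "v \<in> verts G"
  obtains u w where "triangle_component v u w"
proof -
  have card: "card (scc_of v) = 3"
    and ends: "arcs_ends (G \<restriction> scc_of v) = {(x, y). (x, y) \<in> scc_of v \<times> scc_of v \<and> x \<noteq> y}"
    using assms(1) unfolding component_def complete_digraph_def by auto
  have v: "v \<in> scc_of v" using assms(2) by (rule in_scc_of_self)
  have "card (scc_of v - {v}) = 2" using card v by (simp add: card_Diff_singleton)
  then obtain u w where uw: "scc_of v - {v} = {u, w}" "u \<noteq> w" by (auto simp: card_2_iff)
  then have scc: "scc_of v = {v, u, w}" "v \<noteq> u" "v \<noteq> w" using v by auto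
  \<comment> \<open>Edges starting in the component stay there, so adjacency in the induced subgraph
    determines all neighbours in \<open>G\<close>.\<close>
  have adj: "x \<rightarrow> z \<longleftrightarrow> z \<in> scc_of v \<and> x \<noteq> z" if "x \<in> scc_of v" for x z
  proof
    assume "x \<rightarrow> z"
    then show "z \<in> scc_of v \<and> x \<noteq> z" using scc_of_closed[OF that] edge_neq by blast
  next
    assume "z \<in> scc_of v \<and> x \<noteq> z"
    then have "(x, z) \<in> arcs_ends (G \<restriction> scc_of v)" using that by (simp add: ends)
    then show "x \<rightarrow> z" by (simp add: arcs_ends_induce)
  qed
  have "triangle_component v u w"
    unfolding triangle_component_def using uw(2) scc by (auto simp: adj)
  then show ?thesis by (rule that)
qed

section \<open>The trace of a graph algebra\<close>

definition special_vertex :: "'a \<Rightarrow> bool" where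
  "special_vertex v \<longleftrightarrow> degree_of G v \<le> 1 \<or> complete_digraph 3 (component G v)"

text \<open>The monomial basis of the claimed trace: the edge monomials span the square of the
  maximal ideal, and the variables are the additional generators.\<close>

definition trace_monomials :: "('a \<Rightarrow>\<^sub>0 nat) set" where
  "trace_monomials = {var_exp u + var_exp v |u v. u \<rightarrow> v} \<union>
     {var_exp v |v. v \<in> verts G \<and> special_vertex v}"

section \<open>Variables occurring in standard monomials\<close>

lemma standard_cases [consumes 1, case_names zero var edge]:
  assumes "t \<in> standard_monomials G"
  obtains "t = 0" | v where "v \<in> verts G" "t = var_exp v" | u v where "u \<rightarrow> v" "t = var_exp u + var_exp v"
  using assms unfolding standard_monomials_eq by blast

lemma standard_keys_edge:
  assumes "s \<in> standard_monomials G" "lookup s u \<noteq> 0" "lookup s v \<noteq> 0" "u \<noteq> v"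
  shows "u \<rightarrow> v"
  using assms by (auto simp: standard_monomials_def in_keys_iff)

lemma standard_keys_le_2:
  assumes "s \<in> standard_monomials G" "lookup s u \<noteq> 0" "lookup s v \<noteq> 0" "lookup s w \<noteq> 0"
  shows "u = v \<or> u = w \<or> v = w"
proof (rule ccontr)
  assume "\<not> ?thesis"
  then have "card {u, v, w} = 3" by simp
  moreover have "card {u, v, w} \<le> card (Poly_Mapping.keys s)"
    using assms by (intro card_mono) (auto simp: in_keys_iff)
  moreover have "card (Poly_Mapping.keys s) \<le> 2" using assms(1) by (simp add: standard_monomials_def)
  ultimately show False by linarith
qed

lemma standard_lookup_le_1: "s \<in> standard_monomials G \<Longrightarrow> lookup s v \<le> 1"
  by (simp add: standard_monomials_def)

lemma standard_add_var:
  assumes "x + y = var_exp v"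
  shows "x = 0 \<or> y = 0"
proof (rule ccontr)
  assume *: "\<not> ?thesis"
  then obtain a where a: "lookup x a \<noteq> 0" by (metis lookup_zero poly_mapping_eqI)
  obtain b where b: "lookup y b \<noteq> 0" using * by (metis lookup_zero poly_mapping_eqI)
  have "lookup x z + lookup y z = lookup (var_exp v) z" for z
    using arg_cong[OF assms, of "\<lambda>x. lookup x z"] by (simp add: lookup_add)
  from this[of a] this[of b] a b show False
    by (auto simp: lookup_single when_def split: if_splits)
qed

text \<open>A proper standard multiple of a variable is an edge monomial, and all edge monomials
  belong to the set.\<close>

lemma trace_monomials_upward:
  assumes "s + t \<in> standard_monomials G" "s \<in> trace_monomials"
  shows "s + t \<in> trace_monomials"
  using assms(1)
proof (cases rule: standard_cases)
  case zero
  then have "s = 0" by (metis assms(2) UnE keys_zero keys_add_nat Un_empty keys_eq_empty)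
  then show ?thesis using zero assms by simp
next
  case (var v)
  then have "s = 0 \<or> t = 0" by (intro standard_add_var)
  moreover have "Poly_Mapping.keys s \<noteq> {}"
    using assms(2) by (auto simp: trace_monomials_def keys_add_nat simp del: keys_eq_empty)
  ultimately show ?thesis using assms(2) by auto
next
  case (edge u v)
  then show ?thesis by (auto simp: trace_monomials_def)
qed

text \<open>A variable of \<open>u\<close> outside \<open>N\<close> occurs in \<open>s\<close> or in
  \<open>t\<close>. By symmetry it may be taken in \<open>s\<close>, and of the equation
  \<open>s + t = N + u\<close> only the divisibility of \<open>s + t\<close> by \<open>N\<close> is
  kept.\<close>

lemma rigidI:
  assumes "\<And>s t z. s \<in> standard_monomials G \<Longrightarrow> t \<in> standard_monomials G \<Longrightarrow> z \<in> verts G \<Longrightarrow>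
    lookup N z = 0 \<Longrightarrow> lookup s z \<noteq> 0 \<Longrightarrow> (\<And>y. lookup N y \<le> lookup s y + lookup t y) \<Longrightarrow> False"
  shows "rigid N"
  unfolding rigid_def
proof (intro ballI allI impI subsetI)
  fix s t u z
  assume st: "s \<in> standard_monomials G" "t \<in> standard_monomials G" "s + t = N + u"
    and z: "z \<in> Poly_Mapping.keys u"
  have eq: "lookup s y + lookup t y = lookup N y + lookup u y" for y
    using arg_cong[OF st(3), of "\<lambda>x. lookup x y"] by (simp add: lookup_add)
  then have le: "lookup N y \<le> lookup s y + lookup t y" for y by simp
  have "z \<in> Poly_Mapping.keys s \<union> Poly_Mapping.keys t"
    using z by (simp flip: keys_add_nat add: st(3)) (simp add: keys_add_nat)
  then have "z \<in> verts G" using st standard_keys by blast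
  show "z \<in> Poly_Mapping.keys N"
  proof (rule ccontr)
    assume "z \<notin> Poly_Mapping.keys N"
    then have N: "lookup N z = 0" by (simp add: in_keys_iff)
    have "lookup s z \<noteq> 0 \<or> lookup t z \<noteq> 0" using eq[of z] z by (auto simp: in_keys_iff)
    then show False
      using assms[OF st(1,2) \<open>z \<in> verts G\<close> N _ le] assms[OF st(2,1) \<open>z \<in> verts G\<close> N] le
      by (auto simp: add.commute)
  qed
qed

text \<open>Exponent 2 at \<open>u\<close> and \<open>v\<close> forces both vertices into both
  squarefree factors, and a standard monomial has no room for a third vertex.\<close>

lemma rigid_edge:
  assumes "u \<rightarrow> v"
  shows "rigid ((var_exp u + var_exp v) + (var_exp u + var_exp v))"
proof (rule rigidI)
  fix s t z
  assume st: "s \<in> standard_monomials G" "t \<in> standard_monomials G"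
    and z: "lookup ((var_exp u + var_exp v) + (var_exp u + var_exp v)) z = 0" "lookup s z \<noteq> 0"
    and le: "\<And>y. lookup ((var_exp u + var_exp v) + (var_exp u + var_exp v)) y \<le> lookup s y + lookup t y"
  have "u \<noteq> v" using assms by (rule edge_neq)
  have "z \<noteq> u" "z \<noteq> v" using z(1) by (auto simp: lookup_add)
  moreover have "lookup s u \<noteq> 0" "lookup s v \<noteq> 0"
    using le[of u] le[of v] standard_lookup_le_1[OF st(2), of u] standard_lookup_le_1[OF st(2), of v] \<open>u \<noteq> v\<close>
    by (auto simp: lookup_add lookup_single)
  ultimately show False using standard_keys_le_2[OF st(1) _ _ z(2)] \<open>u \<noteq> v\<close> by blast
qed

text \<open>Both factors contain \<open>v\<close>, and any other vertex in a factor would be a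
  neighbour of \<open>v\<close>.\<close>

lemma rigid_isolated:
  assumes "\<And>z. \<not> v \<rightarrow> z"
  shows "rigid (var_exp v + var_exp v)"
proof (rule rigidI)
  fix s t z
  assume st: "s \<in> standard_monomials G" "t \<in> standard_monomials G"
    and z: "lookup (var_exp v + var_exp v) z = 0" "lookup s z \<noteq> 0"
    and le: "\<And>y. lookup (var_exp v + var_exp v) y \<le> lookup s y + lookup t y"
  have "v \<noteq> z" using z(1) by (auto simp: lookup_add)
  moreover have "lookup s v \<noteq> 0"
    using le[of v] standard_lookup_le_1[OF st(2), of v] by (auto simp: lookup_add)
  ultimately show False using standard_keys_edge[OF st(1) _ z(2)] assms by blast
qed

text \<open>Exponent 2 at \<open>v\<close> puts \<open>v\<close> into both factors. Another vertex
  in a factor is then a neighbour of \<open>v\<close>, hence equal to \<open>w\<close>.\<close>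

lemma rigid_leaf:
  assumes "\<And>z. v \<rightarrow> z \<longleftrightarrow> z = w"
  shows "rigid ((var_exp v + var_exp w) + var_exp v)"
proof (rule rigidI)
  fix s t z
  assume st: "s \<in> standard_monomials G" "t \<in> standard_monomials G"
    and z: "lookup ((var_exp v + var_exp w) + var_exp v) z = 0" "lookup s z \<noteq> 0"
    and le: "\<And>y. lookup ((var_exp v + var_exp w) + var_exp v) y \<le> lookup s y + lookup t y"
  have "v \<noteq> z" "w \<noteq> z" using z(1) by (auto simp: lookup_add)
  moreover have "lookup s v \<noteq> 0"
    using le[of v] standard_lookup_le_1[OF st(2), of v] by (auto simp: lookup_add)
  ultimately have "v \<rightarrow> z" using standard_keys_edge[OF st(1) _ z(2)] by simp
  then show False using assms \<open>w \<noteq> z\<close> by simp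
qed

text \<open>The factor \<open>t\<close> holds at most two of the three vertices, so \<open>s\<close>
  contains one of them. A further vertex \<open>z\<close> in \<open>s\<close> would be adjacent to
  it and thus lie in the triangle.\<close>

lemma rigid_triangle:
  assumes "triangle_component v u w"
  shows "rigid ((var_exp u + var_exp w) + var_exp v)"
proof (rule rigidI)
  fix s t z
  assume st: "s \<in> standard_monomials G" "t \<in> standard_monomials G"
    and z: "lookup ((var_exp u + var_exp w) + var_exp v) z = 0" "lookup s z \<noteq> 0"
    and le: "\<And>y. lookup ((var_exp u + var_exp w) + var_exp v) y \<le> lookup s y + lookup t y"
  have neq: "z \<notin> {v, u, w}" using z(1) by (auto simp: lookup_add)
  have "v \<rightarrow> u" "v \<rightarrow> w" "u \<rightarrow> w" using assms by (auto simp: triangle_component_def)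
  then have "v \<noteq> u" "v \<noteq> w" "u \<noteq> w" using edge_neq by blast+
  then have "\<not> (lookup t v \<noteq> 0 \<and> lookup t u \<noteq> 0 \<and> lookup t w \<noteq> 0)"
    using standard_keys_le_2[OF st(2)] by blast
  then obtain y where y: "y \<in> {v, u, w}" "lookup t y = 0" by blast
  then have "lookup s y \<noteq> 0" using le[of y] by (auto simp: lookup_add)
  then have "y \<rightarrow> z" using standard_keys_edge[OF st(1) _ z(2)] y neq by blast
  then show False using y neq assms unfolding triangle_component_def by blast
qed

section \<open>Rigid multiples for the lower bound\<close>

lemma finite_neighbours: "finite {u. v \<rightarrow> u}"
  by (rule finite_subset[OF _ finite_verts]) (auto simp: edge_in_verts)

lemma trace_monomials_rigid:
  assumes "t \<in> trace_monomials"
  shows "\<exists>s\<in>standard_monomials G. rigid (s + t)"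
proof -
  consider u v where "t = var_exp u + var_exp v" "u \<rightarrow> v"
    | v where "t = var_exp v" "v \<in> verts G" "card {u. v \<rightarrow> u} = 0"
    | v where "t = var_exp v" "v \<in> verts G" "card {u. v \<rightarrow> u} = 1"
    | v where "t = var_exp v" "v \<in> verts G" "complete_digraph 3 (component G v)"
    using assms by (force simp: trace_monomials_def special_vertex_def degree_of_def)
  then show ?thesis
  proof cases
    case (1 u v)
    then show ?thesis using rigid_edge edge_standard by blast
  next
    case (2 v)
    \<comment> \<open>Cardinality 0 means emptiness only because the neighbourhood is
      finite.\<close>
    then have "\<not> v \<rightarrow> z" for z using finite_neighbours[of v] by auto
    then show ?thesis using 2 rigid_isolated var_standard by blast
  next
    case (3 v)
    then obtain w where "{u. v \<rightarrow> u} = {w}" by (auto simp: card_1_singleton_iff)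
    then have w: "v \<rightarrow> z \<longleftrightarrow> z = w" for z by auto
    show ?thesis
      unfolding 3(1) using rigid_leaf[OF w] by (rule bexI) (simp add: edge_standard w)
  next
    case (4 v)
    then obtain u w where uw: "triangle_component v u w" using triangle_componentE by blast
    have "u \<rightarrow> w" using uw by (auto simp: triangle_component_def)
    show ?thesis
      unfolding 4(1) using rigid_triangle[OF uw] by (rule bexI) (simp add: edge_standard \<open>u \<rightarrow> w\<close>)
  qed
qed

section \<open>Vanishing matrix entries for the upper bound\<close>

lemma complete_digraph_of_standard:
  assumes "s \<in> standard_monomials G" "verts G \<subseteq> Poly_Mapping.keys s" "verts G \<noteq> {}"
  shows "complete_digraph 1 G \<or> complete_digraph 2 G"
proof -
  have keys: "Poly_Mapping.keys s = verts G" using assms standard_keys by blast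
  \<comment> \<open>The support of \<open>s\<close> is a clique with at most two vertices, and here
    it is the whole vertex set.\<close>
  have "u \<rightarrow> v \<longleftrightarrow> u \<in> verts G \<and> v \<in> verts G \<and> u \<noteq> v" for u v
  proof -
    have "u \<rightarrow> v" if "u \<in> verts G" "v \<in> verts G" "u \<noteq> v"
      using assms(1) that unfolding standard_monomials_def keys[symmetric] by blast
    then show ?thesis using edge_in_verts[of u v] edge_neq[of u v] by blast
  qed
  then have "arcs_ends G = {(u, v). (u, v) \<in> verts G \<times> verts G \<and> u \<noteq> v}"
    by auto
  moreover have "card (verts G) = 1 \<or> card (verts G) = 2"
  proof -
    have "card (verts G) \<le> 2" using assms(1) keys by (auto simp: standard_monomials_def)
    moreover have "card (verts G) \<noteq> 0" using assms(3) by simp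
    ultimately show ?thesis by linarith
  qed
  ultimately show ?thesis
    using graph_axioms by (auto simp: complete_digraph_def)
qed

text \<open>A nonzero entry restricts \<open>G\<close>: for \<open>t = 0\<close> it forces one or
  two pairwise adjacent vertices, and for a variable of a vertex of degree at least 2 it forces a
  triangle component.\<close>

lemma hom_matrix_eq_zero:
  fixes \<phi> :: "(('a, 'k::field) mpoly set \<Rightarrow> 'k) \<Rightarrow> ('a, 'k) mpoly set"
  assumes \<phi>: "\<phi> \<in> canonical_homs" and s: "s \<in> standard_monomials G" and t: "t \<in> standard_monomials G"
    and T: "t \<notin> trace_monomials" and V: "verts G \<noteq> {}"
    and G: "\<not> (complete_digraph 1 G \<or> complete_digraph 2 G)"
  shows "coord (\<phi> (dual_basis s)) t = 0"
proof (rule ccontr)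
  assume nz: "coord (\<phi> (dual_basis s)) t \<noteq> 0"
  from t show False
  proof (cases rule: standard_cases)
    case zero
    have "v \<in> Poly_Mapping.keys s" if "v \<in> verts G" for v
    proof -
      \<comment> \<open>Multiplication by \<open>var_exp v\<close> keeps the monomial
        \<open>0\<close> standard, so a nonzero entry requires that \<open>var_exp v\<close> divides
        \<open>s\<close>. This holds for every vertex.\<close>
      have "\<exists>u. s = var_exp v + u"
        using hom_matrix_zero_right[OF \<phi>, of "var_exp v" 0 0 s] nz s that by (auto simp: var_standard zero)
      then show ?thesis by (auto simp: keys_add_nat)
    qed
    then show False using complete_digraph_of_standard[OF s _ V] G by blast
  next
    case (edge u v)
    then show False using T by (auto simp: trace_monomials_def)
  next
    case (var v)
    have deg: "card {u. v \<rightarrow> u} \<ge> 2" and nt: "\<not> complete_digraph 3 (component G v)"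
      using T var by (auto simp: trace_monomials_def special_vertex_def degree_of_def)
    have nbr: "{u. v \<rightarrow> u} \<subseteq> Poly_Mapping.keys s"
    proof
      fix u assume "u \<in> {u. v \<rightarrow> u}"
      then have "u \<rightarrow> v" using edge_sym by simp
      \<comment> \<open>Multiplication by a neighbour \<open>u\<close> of \<open>v\<close> turns
        \<open>var_exp v\<close> into an edge monomial, so \<open>var_exp u\<close> must divide
        \<open>s\<close>.\<close>
      then have "\<exists>x. s = var_exp u + x"
        using hom_matrix_zero_right[OF \<phi>, of "var_exp u" 0 "var_exp v" s] nz s
        by (auto simp: var_standard edge_standard var edge_in_verts)
      then show "u \<in> Poly_Mapping.keys s" by (auto simp: keys_add_nat)
    qed
    have "card (Poly_Mapping.keys s) \<le> 2" using s by (simp add: standard_monomials_def)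
    \<comment> \<open>At least two neighbours fit into a support of size at most two, so
      \<open>v\<close> has exactly two neighbours and they form \<open>s\<close>.\<close>
    then have eq: "{u. v \<rightarrow> u} = Poly_Mapping.keys s" and "card (Poly_Mapping.keys s) = 2"
      using deg nbr card_seteq[OF finite_keys nbr] card_mono[OF finite_keys nbr] by auto
    from s show False
    proof (cases rule: standard_cases)
      case zero then show ?thesis using \<open>card (Poly_Mapping.keys s) = 2\<close> by simp
    next
      case var then show ?thesis using \<open>card (Poly_Mapping.keys s) = 2\<close> by simp
    next
      case (edge u w)
      \<comment> \<open>Stated for arbitrary \<open>u\<close> and \<open>w\<close>, since it is
        applied with the two neighbours of \<open>v\<close> in either order.\<close>
      have sub: "{z. u \<rightarrow> z} \<subseteq> {v, w}"
        if "v \<rightarrow> u" "v \<rightarrow> w" "u \<rightarrow> w" "s = var_exp u + var_exp w" for u w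
      proof
        fix z assume "z \<in> {z. u \<rightarrow> z}"
        then have "z \<rightarrow> u" using edge_sym by simp
        \<comment> \<open>The shift relation moves the factor \<open>var_exp w\<close> from the
          index \<open>s\<close> to the index \<open>t\<close>.\<close>
        have *: "coord (\<phi> (dual_basis (var_exp u))) (var_exp w + var_exp v) \<noteq> 0"
          using hom_matrix_shift[OF \<phi>, of "var_exp w" "var_exp u" "var_exp v"] that nz edge_sym
          by (simp add: edge_standard var add.commute)
        \<comment> \<open>As \<open>z\<close> is adjacent to \<open>u\<close>, the left vanishing
          relation for \<open>var_exp z\<close> shows that \<open>var_exp z\<close> divides the
          second index, so \<open>z\<close> is \<open>v\<close> or \<open>w\<close>.\<close>
        have "\<exists>x. var_exp w + var_exp v = var_exp z + x"
          using hom_matrix_zero_left[OF \<phi>, of "var_exp z" "var_exp u" 0 "var_exp w + var_exp v"] *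
            \<open>z \<rightarrow> u\<close> that edge_sym by (auto simp: edge_standard var_standard edge_in_verts)
        then obtain x where x: "var_exp w + var_exp v = var_exp z + x" by blast
        have "z \<in> Poly_Mapping.keys (var_exp z + x)" by (simp add: keys_add_nat)
        then show "z \<in> {v, w}" unfolding x[symmetric] by (auto simp: keys_add_nat)
      qed
      have N: "v \<rightarrow> z \<longleftrightarrow> z \<in> {u, w}" for z
        using eq edge by (auto simp: keys_add_nat)
      have adj: "v \<rightarrow> u" "v \<rightarrow> w" "w \<rightarrow> u" using N edge edge_sym by auto
      have "triangle_component v u w"
        unfolding triangle_component_def
        using N sub[of u w] sub[of w u] edge adj edge_sym edge_neq[OF edge(1)]
        by (auto simp: add.commute)
      then show False using nt triangle_componentI by blast
    qed
  qed
qed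

lemma trace_ideal_eq:
  assumes "verts G \<noteq> {}" "\<not> (complete_digraph 1 G \<or> complete_digraph 2 G)"
  shows "(trace_ideal :: ('a, 'k::field) mpoly set set) = coord_subspace trace_monomials"
proof (rule subset_antisym)
  show "(trace_ideal :: ('a, 'k) mpoly set set) \<subseteq> coord_subspace trace_monomials"
    by (rule trace_subset_coord_subspace) (use assms trace_monomials_upward hom_matrix_eq_zero in blast)+
  show "coord_subspace trace_monomials \<subseteq> (trace_ideal :: ('a, 'k) mpoly set set)"
    by (rule coord_subspace_subset_trace) (rule trace_monomials_rigid)
qed

section \<open>The maximal ideal and the ideal-theoretic form of the trace\<close>

abbreviation max_ideal :: "('a, 'k::field) mpoly set set"
  where "max_ideal \<equiv> graph_max_ideal G"

lemma max_ideal_gens: "{residue_class G (mpoly_var v) |v. v \<in> verts G} \<subseteq> carrier \<A>"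
  by (auto simp: residue_class_var monom_class_closed)

lemma max_ideal_subset: "(max_ideal :: ('a, 'k::field) mpoly set set) \<subseteq> coord_subspace (- {0})"
proof -
  interpret A: cring "\<A> :: ('k, ('a, 'k) mpoly set) module" by (rule cring_graph_algebra)
  have "ideal (coord_subspace (- {0}) :: ('a, 'k) mpoly set set) \<A>"
    by (rule ideal_coord_subspace) (metis ComplI Compl_iff keys_add_nat keys_eq_empty singleton_iff sup_eq_bot_iff)
  moreover have "{residue_class G (mpoly_var v) |v. v \<in> verts G} \<subseteq> (coord_subspace (- {0}) :: ('a, 'k) mpoly set set)"
    by (auto simp: residue_class_var coord_subspace_def monom_class_closed coord_monom_class var_exp_nonzero)
  ultimately show ?thesis unfolding graph_max_ideal_def by (rule A.genideal_minimal)
qed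

lemma ideal_max_ideal: "ideal (max_ideal :: ('a, 'k::field) mpoly set set) \<A>"
proof -
  interpret A: cring "\<A> :: ('k, ('a, 'k) mpoly set) module" by (rule cring_graph_algebra)
  show ?thesis unfolding graph_max_ideal_def by (rule A.genideal_ideal[OF max_ideal_gens])
qed

lemma var_in_max_ideal:
  assumes "v \<in> verts G"
  shows "monom_class c (var_exp v) \<in> (max_ideal :: ('a, 'k::field) mpoly set set)"
proof -
  interpret A: cring "\<A> :: ('k, ('a, 'k) mpoly set) module" by (rule cring_graph_algebra)
  interpret M: ideal "max_ideal :: ('a, 'k) mpoly set set" \<A> by (rule ideal_max_ideal)
  have "monom_class 1 (var_exp v) \<in> (max_ideal :: ('a, 'k) mpoly set set)"
    using A.genideal_self[OF max_ideal_gens] assms unfolding graph_max_ideal_def residue_class_var by blast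
  then have "monom_class c 0 \<otimes>\<^bsub>\<A>\<^esub> monom_class 1 (var_exp v) \<in> (max_ideal :: ('a, 'k) mpoly set set)"
    by (intro M.I_l_closed) (auto simp: monom_class_closed)
  then show ?thesis using assms by (simp add: monom_class_mult)
qed

text \<open>This translates the span of \<open>trace_monomials\<close> into ideals. Both ideals have
  coordinates only at these monomials, and each of these monomials is a product of two variables or
  one of the generating variables.\<close>

lemma coord_subspace_trace_monomials:
  "(coord_subspace trace_monomials :: ('a, 'k::field) mpoly set set) =
    (max_ideal \<cdot>\<^bsub>\<A>\<^esub> max_ideal) <+>\<^bsub>\<A>\<^esub>
      genideal \<A> {residue_class G (mpoly_var v) | v. v \<in> verts G \<and> special_vertex v}"
  (is "?H = ?I <+>\<^bsub>\<A>\<^esub> ?J")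
proof
  interpret A: cring "\<A> :: ('k, ('a, 'k) mpoly set) module" by (rule cring_graph_algebra)
  interpret M: ideal "max_ideal :: ('a, 'k) mpoly set set" \<A> by (rule ideal_max_ideal)
  interpret H: ideal ?H \<A> by (rule ideal_coord_subspace) (rule trace_monomials_upward)
  have gens: "{residue_class G (mpoly_var v) | v. v \<in> verts G \<and> special_vertex v} \<subseteq>
      carrier (\<A> :: ('k, ('a, 'k) mpoly set) module)"
    using max_ideal_gens by blast
  have I: "ideal ?I \<A>" by (rule A.ideal_prod_is_ideal[OF ideal_max_ideal ideal_max_ideal])
  have J: "ideal ?J \<A>" by (rule A.genideal_ideal[OF gens])
  interpret I: ideal ?I \<A> by (rule I)
  interpret J: ideal ?J \<A> by (rule J)
  interpret S: ideal "?I <+>\<^bsub>\<A>\<^esub> ?J" \<A> by (rule A.add_ideals[OF I J])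
  \<comment> \<open>Elements of the maximal ideal have no constant term, so a monomial of
    \<open>i\<close> times \<open>j\<close> splits into two nontrivial factors. The only standard
    monomials with such a splitting are the edge monomials.\<close>
  have prod: "i \<otimes>\<^bsub>\<A>\<^esub> j \<in> ?H" if "i \<in> max_ideal" "j \<in> max_ideal" for i j
  proof -
    have ij: "i \<in> carrier \<A>" "j \<in> carrier \<A>" "i \<in> coord_subspace (- {0})" "j \<in> coord_subspace (- {0})"
      using that max_ideal_subset M.Icarr by blast+
    then have zero: "coord i 0 = 0" "coord j 0 = 0"
      using coord_subspaceD[OF _ zero_standard] by blast+
    have "coord (i \<otimes>\<^bsub>\<A>\<^esub> j) t = 0" if t: "t \<in> standard_monomials G" "t \<notin> trace_monomials" for t
    proof (rule ccontr)
      assume "coord (i \<otimes>\<^bsub>\<A>\<^esub> j) t \<noteq> 0"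
      then obtain x y where xy: "t = x + y" "coord i x \<noteq> 0" "coord j y \<noteq> 0"
        using ij t by (auto elim: coord_mult_nonzeroE)
      then have "x \<noteq> 0" "y \<noteq> 0" using zero by metis+
      from t(1) show False
      proof (cases rule: standard_cases)
        case zero
        then show ?thesis using xy(1) \<open>x \<noteq> 0\<close> by (metis keys_add_nat keys_eq_empty sup_eq_bot_iff)
      next
        case (var v)
        then show ?thesis using xy(1) \<open>x \<noteq> 0\<close> \<open>y \<noteq> 0\<close> standard_add_var by metis
      next
        case (edge u v)
        then show ?thesis using t(2) by (auto simp: trace_monomials_def)
      qed
    qed
    then show ?thesis using ij by (intro coord_subspaceI A.m_closed)
  qed
  have IH: "?I \<subseteq> ?H"
  proof
    fix a assume "a \<in> ?I"
    then show "a \<in> ?H"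
      by (induction rule: ideal_prod.induct) (use prod H.a_closed in auto)
  qed
  have "{residue_class G (mpoly_var v) | v. v \<in> verts G \<and> special_vertex v} \<subseteq> ?H"
  proof
    fix a :: "('a, 'k) mpoly set"
    assume "a \<in> {residue_class G (mpoly_var v) | v. v \<in> verts G \<and> special_vertex v}"
    then obtain v where v: "a = monom_class 1 (var_exp v)" "v \<in> verts G" "special_vertex v"
      by (auto simp: residue_class_var)
    then have "var_exp v \<in> trace_monomials" by (auto simp: trace_monomials_def)
    then show "a \<in> ?H"
      using v(2) unfolding v(1) by (intro coord_subspaceI) (auto simp: monom_class_closed coord_monom_class)
  qed
  then have JH: "?J \<subseteq> ?H" by (rule A.genideal_minimal[OF H.ideal_axioms])
  show "?I <+>\<^bsub>\<A>\<^esub> ?J \<subseteq> ?H"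
    unfolding set_add_def' using IH JH H.a_closed by blast
  have IS: "a \<in> ?I <+>\<^bsub>\<A>\<^esub> ?J" if "a \<in> ?I" for a
  proof -
    have "a \<oplus>\<^bsub>\<A>\<^esub> \<zero>\<^bsub>\<A>\<^esub> \<in> ?I <+>\<^bsub>\<A>\<^esub> ?J"
      unfolding set_add_def' using that J.zero_closed by blast
    then show ?thesis using A.r_zero[OF I.Icarr[OF that]] by metis
  qed
  have JS: "a \<in> ?I <+>\<^bsub>\<A>\<^esub> ?J" if "a \<in> ?J" for a
  proof -
    have "\<zero>\<^bsub>\<A>\<^esub> \<oplus>\<^bsub>\<A>\<^esub> a \<in> ?I <+>\<^bsub>\<A>\<^esub> ?J"
      unfolding set_add_def' using that I.zero_closed by blast
    then show ?thesis using A.l_zero[OF J.Icarr[OF that]] by metis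
  qed
  show "?H \<subseteq> ?I <+>\<^bsub>\<A>\<^esub> ?J"
  proof
    fix a assume a: "a \<in> ?H"
    then have "a \<in> carrier \<A>" by (rule coord_subspace_carrier)
    then show "a \<in> ?I <+>\<^bsub>\<A>\<^esub> ?J"
    proof (induction rule: monom_sum_induct)
      case zero
      show ?case by (rule S.zero_closed)
    next
      case (add x y)
      then show ?case by (intro S.a_closed)
    next
      case (monom s c)
      \<comment> \<open>Since \<open>c\<close> is the coordinate of \<open>a\<close> at
        \<open>s\<close>, it vanishes unless \<open>s\<close> is one of the trace monomials.\<close>
      consider "c = 0" | u v where "u \<rightarrow> v" "s = var_exp u + var_exp v"
        | v where "v \<in> verts G" "special_vertex v" "s = var_exp v"
        using coord_subspaceD[OF a monom(1)] monom(2) unfolding trace_monomials_def by blast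
      then show ?case
      proof cases
        case 1
        then show ?thesis using S.zero_closed by (simp add: monom_class_def residue_class_zero)
      next
        case (2 u v)
        have "monom_class c (var_exp u) \<otimes>\<^bsub>\<A>\<^esub> monom_class 1 (var_exp v) \<in> ?I"
          using 2 by (intro ideal_prod.prod var_in_max_ideal) (auto simp: edge_in_verts)
        then show ?thesis using 2 by (intro IS) (simp add: monom_class_mult edge_in_verts)
      next
        case (3 v)
        have "monom_class 1 (var_exp v) \<in> ?J"
          using A.genideal_self[OF gens] 3 unfolding residue_class_var by blast
        then have "monom_class c 0 \<otimes>\<^bsub>\<A>\<^esub> monom_class 1 (var_exp v) \<in> ?J"
          by (intro J.I_l_closed) (auto simp: monom_class_closed)
        then show ?thesis using 3 by (intro JS) (simp add: monom_class_mult)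
      qed
    qed
  qed
qed

section \<open>Graphs on one or two vertices\<close>

text \<open>The product of all variables is standard because \<open>G\<close> is complete on at most
  two vertices. No vertex lies outside its support, which makes it rigid, and squarefree monomials
  divide it.\<close>

lemma top_monomial:
  assumes "complete_digraph 1 G \<or> complete_digraph 2 G"
  obtains N where "N \<in> standard_monomials G" "Poly_Mapping.keys N = verts G" "rigid N"
    "\<And>t. t \<in> standard_monomials G \<Longrightarrow> \<exists>u. N = t + u"
proof -
  define N where "N = (\<Sum>v\<in>verts G. var_exp v)"
  have N: "lookup N v = (if v \<in> verts G then 1 else 0)" for v
    by (simp add: N_def lookup_sum lookup_single when_def)
  have keys: "Poly_Mapping.keys N = verts G" by (auto simp: in_keys_iff N split: if_splits)
  show ?thesis
  proof
    show "Poly_Mapping.keys N = verts G" by (rule keys)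
    show "N \<in> standard_monomials G"
      using assms by (auto simp: standard_monomials_def keys N complete_digraph_def)
    show "rigid N" by (rule rigidI) (auto simp: N)
    show "\<exists>u. N = t + u" if t: "t \<in> standard_monomials G" for t
    proof -
      have "lookup t v \<le> lookup N v" for v
        using standard_lookup_le_1[OF t, of v] standard_keys[OF t] by (auto simp: N in_keys_iff)
      then show ?thesis using monomial_dvdE by blast
    qed
  qed
qed

text \<open>Every standard monomial has a standard cofactor in the rigid top monomial, so the lower
  bound already covers the whole algebra.\<close>

lemma trace_ideal_complete:
  assumes "complete_digraph 1 G \<or> complete_digraph 2 G"
  shows "(trace_ideal :: ('a, 'k::field) mpoly set set) = carrier \<A>"
proof (rule subset_antisym)
  show "(trace_ideal :: ('a, 'k) mpoly set set) \<subseteq> carrier \<A>" by (rule trace_ideal_subset_carrier)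
  obtain N where N: "N \<in> standard_monomials G" "rigid N"
    "\<And>t. t \<in> standard_monomials G \<Longrightarrow> \<exists>u. N = t + u"
    using top_monomial[OF assms] by metis
  have "coord_subspace UNIV \<subseteq> (trace_ideal :: ('a, 'k) mpoly set set)"
  proof (rule coord_subspace_subset_trace)
    fix t assume "t \<in> standard_monomials G"
    then obtain u where u: "N = u + t" using N(3) by (metis add.commute)
    then have "u \<in> standard_monomials G" using N(1) standard_monomials_divisor by blast
    then show "\<exists>s\<in>standard_monomials G. rigid (s + t)" using N(2) u by blast
  qed
  then show "carrier \<A> \<subseteq> (trace_ideal :: ('a, 'k) mpoly set set)"
    by (simp add: coord_subspace_def)
qed

text \<open>Below the top monomial some variable can still be multiplied in without leaving the
  standard monomials, so a socle element has no such coordinate. Conversely, multiplying the top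
  monomial by a nontrivial monomial creates an exponent of at least 2.\<close>

lemma socle_complete:
  assumes "N \<in> standard_monomials G" "Poly_Mapping.keys N = verts G"
    "\<And>t. t \<in> standard_monomials G \<Longrightarrow> \<exists>u. N = t + u"
  shows "socle \<A> max_ideal = range (\<lambda>c :: 'k::field. monom_class c N)"
proof (rule subset_antisym; rule subsetI)
  fix a :: "('a, 'k) mpoly set"
  assume "a \<in> socle \<A> max_ideal"
  then have a: "a \<in> carrier \<A>" "\<And>x. x \<in> max_ideal \<Longrightarrow> x \<otimes>\<^bsub>\<A>\<^esub> a = \<zero>\<^bsub>\<A>\<^esub>"
    by (auto simp: socle_def)
  have "coord a t = 0" if t: "t \<in> standard_monomials G" "t \<noteq> N" for t
  proof -
    obtain u where u: "N = t + u" using assms(3) t by blast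
    with t(2) have "u \<noteq> 0" by auto
    then obtain v where v: "lookup u v \<noteq> 0" by (metis lookup_zero poly_mapping_eqI)
    then obtain u' where u': "u = var_exp v + u'" by (rule var_exp_dvdE)
    then have "N = (var_exp v + t) + u'" using u by (simp add: ac_simps)
    \<comment> \<open>The coordinate of \<open>a\<close> at \<open>t\<close> reappears in the
      product with \<open>var_exp v\<close> at this standard monomial, and that product is
      zero.\<close>
    then have std: "var_exp v + t \<in> standard_monomials G"
      using assms(1) standard_monomials_divisor by blast
    have "v \<in> verts G" using v u assms(2) by (auto simp: in_keys_iff keys_add_nat simp flip: assms(2))
    then have "monom_class 1 (var_exp v) \<otimes>\<^bsub>\<A>\<^esub> a = \<zero>\<^bsub>\<A>\<^esub>"
      using a var_in_max_ideal by blast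
    then have "coord (monom_class 1 (var_exp v) \<otimes>\<^bsub>\<A>\<^esub> a) (var_exp v + t) = 0"
      using std by (simp add: coord_zero)
    then show ?thesis using a std \<open>v \<in> verts G\<close> by (simp add: coord_monom_mult)
  qed
  then have "a = monom_class (coord a N) N"
    using a assms by (intro coord_eqI) (auto simp: monom_class_closed coord_monom_class)
  then show "a \<in> range (\<lambda>c. monom_class c N)" by blast
next
  fix a :: "('a, 'k) mpoly set"
  assume "a \<in> range (\<lambda>c. monom_class c N)"
  then obtain c where a: "a = monom_class c N" by blast
  have closed: "a \<in> carrier \<A>" using assms(2) by (simp add: a monom_class_closed)
  interpret A: cring "\<A> :: ('k, ('a, 'k) mpoly set) module" by (rule cring_graph_algebra)
  have "x \<otimes>\<^bsub>\<A>\<^esub> a = \<zero>\<^bsub>\<A>\<^esub>" if "x \<in> max_ideal" for x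
  proof (rule coord_eqI)
    have x: "x \<in> coord_subspace (- {0})" using that max_ideal_subset by blast
    then have xc: "x \<in> carrier \<A>" by (simp add: coord_subspace_def)
    then show "x \<otimes>\<^bsub>\<A>\<^esub> a \<in> carrier \<A>" using closed by simp
    fix t assume t: "t \<in> standard_monomials G"
    show "coord (x \<otimes>\<^bsub>\<A>\<^esub> a) t = coord \<zero>\<^bsub>\<A>\<^esub> t"
    proof (rule ccontr)
      assume "\<not> ?thesis"
      then have "coord (x \<otimes>\<^bsub>\<A>\<^esub> a) t \<noteq> 0" using t by (simp add: coord_zero)
      then obtain u n where un: "t = u + n" "coord x u \<noteq> 0" "coord a n \<noteq> 0"
        using xc closed t by (auto elim: coord_mult_nonzeroE)
      have "n \<in> standard_monomials G" using t un standard_monomials_divisor' by blast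
      then have "n = N" using un(3) assms by (auto simp: a coord_monom_class split: if_splits)
      have "coord x 0 = 0" using x zero_standard by (simp add: coord_subspace_def)
      then have "u \<noteq> 0" using un(2) by metis
      then obtain v where v: "lookup u v \<noteq> 0" by (metis lookup_zero poly_mapping_eqI)
      have "u \<in> standard_monomials G" using t un standard_monomials_divisor by blast
      moreover have "v \<in> Poly_Mapping.keys u" using v by (simp add: in_keys_iff)
      ultimately have "v \<in> Poly_Mapping.keys N" using standard_keys assms(2) by blast
      \<comment> \<open>The vertex \<open>v\<close> occurs in \<open>u\<close> and in the top
        monomial, contradicting that \<open>t\<close> is squarefree.\<close>
      then have "lookup t v \<ge> 2" using v \<open>n = N\<close> un(1) by (auto simp: lookup_add in_keys_iff)
      then show False using standard_lookup_le_1[OF t, of v] by simp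
    qed
  qed simp
  then show "a \<in> socle \<A> max_ideal" using closed by (simp add: socle_def)
qed

lemma artinian_gorenstein_complete:
  assumes "complete_digraph 1 G \<or> complete_digraph 2 G"
  shows "artinian_gorenstein ring_of_type_algebra (\<A> :: ('k::field, _) module) max_ideal"
proof -
  interpret A: cring "\<A> :: ('k, ('a, 'k) mpoly set) module" by (rule cring_graph_algebra)
  obtain N where N: "N \<in> standard_monomials G" "Poly_Mapping.keys N = verts G"
    "\<And>t. t \<in> standard_monomials G \<Longrightarrow> \<exists>u. N = t + u"
    using top_monomial[OF assms] by metis
  let ?K = "(\<lambda>c. c \<odot>\<^bsub>\<A>\<^esub> \<one>\<^bsub>\<A>\<^esub>) ` carrier (ring_of_type_algebra :: 'k ring)"
  have K: "?K = range (\<lambda>c. monom_class c 0)"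
    by (simp add: ring_of_type_algebra_def smult_eq_mult monom_class_closed)
  \<comment> \<open>The socle is the zero space extended by the line of the top monomial. That
    monomial is nonzero, so one inductive step of \<open>dimension\<close> suffices.\<close>
  have "A.line_extension ?K (monom_class 1 N) {\<zero>\<^bsub>\<A>\<^esub>} = range (\<lambda>c. monom_class c N)"
    unfolding K using N(2) by (auto simp: A.line_extension_mem_iff monom_class_mult monom_class_closed)
  then have eq: "socle \<A> max_ideal = A.line_extension ?K (monom_class 1 N) {\<zero>\<^bsub>\<A>\<^esub>}"
    using socle_complete[OF N] by simp
  have "monom_class 1 N \<noteq> (\<zero>\<^bsub>\<A>\<^esub> :: ('a, 'k) mpoly set)"
    using coord_monom_class[of N N "1::'k"] coord_zero[OF N(1), where ?'c = 'k] N by auto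
  then have "A.dimension (Suc 0) ?K (A.line_extension ?K (monom_class 1 N) {\<zero>\<^bsub>\<A>\<^esub>})"
    using N(2) by (intro A.Suc_dim A.zero_dim) (auto simp: monom_class_closed)
  then show ?thesis unfolding artinian_gorenstein_def eq by simp
qed

end

theorem theorem8p1:
  fixes G :: "('v, 'e) pre_digraph"
  assumes "graph G" and "verts G \<noteq> {}"
  shows "let K = (ring_of_type_algebra :: 'k::field ring);
             A = (graph_algebra G :: ('k, ('v, 'k) mpoly set) module);
             \<mm> = graph_max_ideal G
         in (complete_digraph 1 G \<or> complete_digraph 2 G \<longrightarrow>
               artinian_gorenstein K A \<mm> \<and> canonical_trace K A = carrier A) \<and>
            (\<not> (complete_digraph 1 G \<or> complete_digraph 2 G) \<longrightarrow>
               canonical_trace K A =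
                 (\<mm> \<cdot>\<^bsub>A\<^esub> \<mm>) <+>\<^bsub>A\<^esub>
                 genideal A {residue_class G (mpoly_var v) | v. v \<in> verts G \<and>
                   (degree_of G v \<le> 1 \<or> complete_digraph 3 (component G v))})"
proof -
  interpret graph G by (rule assms(1))
  show ?thesis
    unfolding Let_def
    using artinian_gorenstein_complete trace_ideal_complete trace_ideal_eq[OF assms(2)]
      coord_subspace_trace_monomials[unfolded special_vertex_def]
    by blast
qed

end
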